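(* Let $k,l,m,n$ be integers such that $n=k(m-l)+l$, where $k\geq 1$, $m\geq 2$ and $\lceil \frac{m}{2}\rceil\leq l<m$. Let $K$ be a field, $R=K[x_1,\dots,x_n]$, and let $I_{m,l,k}=(u_1,\dots,u_k)\subseteq R$ with $u_i=\prod_{j=1}^{m}x_{(i-1)(m-l)+j}$ for $1\leq i\leq k$. Suppose $m\equiv s\pmod{m-l}$ with $s$ an integer such that $1\leq s<m-l$, and write $n=p(2m-l-s)+d$ with integers $p,d$ such that $0\leq d<2m-l-s$. Then $\mathrm{pd}(I_{m,l,k})=2p-1$ if $d\neq m$, and $\mathrm{pd}(I_{m,l,k})=2p$ if $d=m$.
   Context: $R$ is graded in the standard way ($\deg x_i=1$), and $\lceil a\rceil$ denotes the smallest integer $\ge a$. For a homogeneous ideal $I\subseteq R$, $\beta_{i,j}(I)$ denotes the $(i,j)$-th graded Betti number of $I$ viewed as an $R$-module, i.e. the number of copies of $R(-j)$ in homological degree $i$ of the minimal graded free resolution of $I$ over $R$. The projective dimension is $\mathrm{pd}(I)=\max\{i : \beta_{i,j}(I)\neq 0 \text{ for some } j\}$. It is an invariant of the ideal $I$ as a module, not of $R/I$. *)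

theory Defs
  imports
    "HOL-Library.Poly_Mapping"
    "HOL-Number_Theory.Cong"
    "Jordan_Normal_Form.Matrix"
begin

text \<open>
  A polynomial is a finitely supported map from exponent vectors to coefficients. The number of
  variables is a value and not a type, so \<open>R = K[x_1, ..., x_n]\<close> is the subring \<open>poly_ring n\<close>
  of the ring \<open>K[x_0, x_1, ...]\<close>, where \<open>K\<close> is the coefficient type.
\<close>

type_synonym 'a mvpoly = "(nat \<Rightarrow>\<^sub>0 nat) \<Rightarrow>\<^sub>0 'a"

definition pvar :: "nat \<Rightarrow> 'a::field mvpoly" where
  "pvar i = Poly_Mapping.single (Poly_Mapping.single i 1) 1"

definition poly_ring :: "nat \<Rightarrow> 'a::field mvpoly set" where
  "poly_ring n = {f. \<forall>e \<in> Poly_Mapping.keys f. Poly_Mapping.keys e \<subseteq> {1..n}}"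

definition mono_deg :: "(nat \<Rightarrow>\<^sub>0 nat) \<Rightarrow> nat" where
  "mono_deg e = (\<Sum>i \<in> Poly_Mapping.keys e. Poly_Mapping.lookup e i)"

text \<open>The zero polynomial is homogeneous of every degree, and it is the only one that is
  homogeneous of a negative degree.\<close>

definition homogeneous :: "int \<Rightarrow> 'a::field mvpoly \<Rightarrow> bool" where
  "homogeneous d f \<longleftrightarrow> (\<forall>e \<in> Poly_Mapping.keys f. int (mono_deg e) = d)"

definition ideal_gen :: "nat \<Rightarrow> 'a::field mvpoly set \<Rightarrow> 'a mvpoly set" where
  "ideal_gen n U =
     {\<Sum>u\<in>S. c u * u | S c. finite S \<and> S \<subseteq> U \<and> (\<forall>u\<in>S. c u \<in> poly_ring n)}"

definition free_mod :: "nat \<Rightarrow> nat \<Rightarrow> 'a::field mvpoly vec set" where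
  "free_mod n r = {v \<in> carrier_vec r. \<forall>a<r. v $ a \<in> poly_ring n}"

text \<open>
  A minimal graded free resolution
  \<open>... \<rightarrow> F_2 \<rightarrow> F_1 \<rightarrow> F_0 \<rightarrow> I \<rightarrow> 0\<close> over \<open>R\<close> of an ideal \<open>I\<close>, with bases chosen:
  \<^item> \<open>F_i\<close> is the direct sum of the \<open>R(-j)\<close> over the entries \<open>j\<close> of the list \<open>tw i\<close>,
    so its \<open>a\<close>-th basis element has degree \<open>tw i ! a\<close>;
  \<^item> \<open>aug\<close> lists the images in \<open>I\<close> of the basis of \<open>F_0\<close>;
  \<^item> \<open>D i\<close> is the matrix of the map \<open>F_(i+1) \<rightarrow> F_i\<close>.

  The maps preserve degrees exactly if the matrix entries are homogeneous of the degrees below.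
  Minimality says that the image of \<open>F_(i+1)\<close> lies in \<open>(x_1, ..., x_n) F_i\<close>, that is, that all
  entries of \<open>D i\<close> lie in \<open>(x_1, ..., x_n)\<close>. The ideal \<open>I\<close> sits in homological degree \<open>-1\<close>, so
  the indices are those of a resolution of \<open>I\<close> and not of \<open>R/I\<close>.
\<close>

locale minimal_graded_free_resolution =
  fixes n :: nat
    and I :: "'a::field mvpoly set"
    and tw :: "nat \<Rightarrow> int list"
    and aug :: "'a mvpoly vec"
    and D :: "nat \<Rightarrow> 'a mvpoly mat"
  assumes aug_carrier: "aug \<in> free_mod n (length (tw 0))"
    and aug_graded: "\<And>a. a < length (tw 0) \<Longrightarrow> homogeneous (tw 0 ! a) (aug $ a)"
    and D_carrier: "\<And>i. D i \<in> carrier_mat (length (tw i)) (length (tw (Suc i)))"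
    and D_entries: "\<And>i. elements_mat (D i) \<subseteq> poly_ring n"
    and D_graded: "\<And>i a b. a < length (tw i) \<Longrightarrow> b < length (tw (Suc i)) \<Longrightarrow>
          homogeneous (tw (Suc i) ! b - tw i ! a) (D i $$ (a, b))"
    and aug_surj: "{aug \<bullet> v | v. v \<in> free_mod n (length (tw 0))} = I"
    and exact_0: "{v \<in> free_mod n (length (tw 0)). aug \<bullet> v = 0} =
          {D 0 *\<^sub>v w | w. w \<in> free_mod n (length (tw 1))}"
    and exact_Suc: "\<And>i. {v \<in> free_mod n (length (tw (Suc i))). D i *\<^sub>v v = 0\<^sub>v (length (tw i))} =
          {D (Suc i) *\<^sub>v w | w. w \<in> free_mod n (length (tw (Suc (Suc i))))}"
    and minimal: "\<And>i. elements_mat (D i) \<subseteq> ideal_gen n (pvar ` {1..n})"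

text \<open>
  The number of copies of \<open>R(-j)\<close> in homological degree \<open>i\<close> is the same for every minimal graded
  free resolution of \<open>I\<close>, since these are unique up to isomorphism. The value is meaningful if
  \<open>I\<close> is a homogeneous ideal of \<open>poly_ring n\<close>, in which case a resolution exists.
\<close>

definition graded_betti :: "nat \<Rightarrow> 'a::field mvpoly set \<Rightarrow> nat \<Rightarrow> int \<Rightarrow> nat" where
  "graded_betti n I i j =
     (THE b. \<exists>tw aug D. minimal_graded_free_resolution n I tw aug D \<and> b = count_list (tw i) j)"

definition proj_dim :: "nat \<Rightarrow> 'a::field mvpoly set \<Rightarrow> nat" where
  "proj_dim n I = Max {i. \<exists>j. graded_betti n I i j \<noteq> 0}"

end

theory Submission
  imports Defs "Jordan_Normal_Form.Determinant"
begin

text \<open>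
  Let \<open>t = m - l\<close> and \<open>m = q t + s\<close>. The \<open>i\<close>-th generator is the product of a window of \<open>q\<close> full
  blocks of \<open>t\<close> variables followed by \<open>s\<close> variables of the next block. A squarefree monomial \<open>x g\<close>,
  where the variable \<open>x\<close> does not occur in the generators of \<open>J\<close>, satisfies \<open>J : x g = J : g\<close>. Hence the
  comparison map from the resolution of \<open>R/(J : g)\<close> to that of \<open>R/J\<close> over the multiplication by \<open>x g\<close> may
  be chosen divisible by \<open>x\<close>, the mapping cone is a minimal resolution of \<open>R/(J + (x g))\<close>, and
  \<open>pd R/(J + (x g)) = max (pd R/J) (pd R/(J : g) + 1)\<close>. If \<open>J_k\<close> is generated by the first \<open>k\<close> windows,
  then the colon ideal of \<open>J_k\<close> by the next window is generated by \<open>J_(k-q)\<close> and one full block,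
  and the colon ideal of \<open>J_(k-q)\<close> by this block only truncates its last window, which does not
  change the projective dimension. This gives
  \<open>P (k + 1) = max (P k) (P (k - q) + 2)\<close> for \<open>P k = pd R/J_k\<close>.

  Betti numbers are well defined because two minimal resolutions are compared by chain maps whose
  composites are homotopic to the identity, hence are the identity modulo the maximal ideal.
\<close>

subsection \<open>Polynomials\<close>

lemma keys_plus_nat:
  fixes e e' :: "nat \<Rightarrow>\<^sub>0 nat"
  shows "Poly_Mapping.keys (e + e') = Poly_Mapping.keys e \<union> Poly_Mapping.keys e'"
  by (auto simp: in_keys_iff lookup_add)

lemma mono_deg_superset:
  assumes "finite A" "Poly_Mapping.keys e \<subseteq> A"
  shows "mono_deg e = (\<Sum>i\<in>A. Poly_Mapping.lookup e i)"
  unfolding mono_deg_def using assms by (intro sum.mono_neutral_left) (auto simp: in_keys_iff)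

lemma mono_deg_add: "mono_deg (e + e') = mono_deg e + mono_deg e'"
proof -
  define A where "A = Poly_Mapping.keys e \<union> Poly_Mapping.keys e'"
  have "finite A" "Poly_Mapping.keys e \<subseteq> A" "Poly_Mapping.keys e' \<subseteq> A"
    "Poly_Mapping.keys (e + e') \<subseteq> A"
    by (auto simp: A_def keys_plus_nat)
  then show ?thesis
    by (simp add: mono_deg_superset[of A] lookup_add sum.distrib)
qed

lemma mono_deg_zero [simp]: "mono_deg 0 = 0"
  by (simp add: mono_deg_def)

lemma poly_ring_zero [simp]: "0 \<in> poly_ring n"
  by (simp add: poly_ring_def)

lemma poly_ring_one [simp]: "1 \<in> poly_ring n"
  by (simp add: poly_ring_def)

lemma poly_ring_add [intro]: "f \<in> poly_ring n \<Longrightarrow> g \<in> poly_ring n \<Longrightarrow> f + g \<in> poly_ring n"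
  using Poly_Mapping.keys_add[of f g] by (auto simp: poly_ring_def)

lemma poly_ring_uminus [intro]: "f \<in> poly_ring n \<Longrightarrow> - f \<in> poly_ring n"
  by (auto simp: poly_ring_def)

lemma poly_ring_diff [intro]: "f \<in> poly_ring n \<Longrightarrow> g \<in> poly_ring n \<Longrightarrow> f - g \<in> poly_ring n"
  using poly_ring_add[of f n "- g"] poly_ring_uminus[of g n] by simp

lemma poly_ring_mult [intro]: "f \<in> poly_ring n \<Longrightarrow> g \<in> poly_ring n \<Longrightarrow> f * g \<in> poly_ring n"
  using Poly_Mapping.keys_mult[of f g] by (fastforce simp: poly_ring_def keys_plus_nat)

lemma poly_ring_sum [intro]: "(\<And>i. i \<in> A \<Longrightarrow> f i \<in> poly_ring n) \<Longrightarrow> sum f A \<in> poly_ring n"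
  by (induction A rule: infinite_finite_induct) auto

lemma poly_ring_single [intro]:
  "Poly_Mapping.keys e \<subseteq> {1..n} \<Longrightarrow> Poly_Mapping.single e c \<in> poly_ring n"
  by (auto simp: poly_ring_def)

lemma homogeneous_zero [simp]: "homogeneous d 0"
  by (simp add: homogeneous_def)

lemma homogeneous_one [simp]: "homogeneous 0 1"
  by (simp add: homogeneous_def)

lemma homogeneous_uminus [simp]: "homogeneous d (- f) \<longleftrightarrow> homogeneous d f"
  by (simp add: homogeneous_def)

lemma homogeneous_add: "homogeneous d f \<Longrightarrow> homogeneous d g \<Longrightarrow> homogeneous d (f + g)"
  using Poly_Mapping.keys_add[of f g] by (auto simp: homogeneous_def)

lemma homogeneous_sum: "(\<And>i. i \<in> A \<Longrightarrow> homogeneous d (f i)) \<Longrightarrow> homogeneous d (sum f A)"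
  by (induction A rule: infinite_finite_induct) (auto intro: homogeneous_add)

lemma homogeneous_mult: "homogeneous d f \<Longrightarrow> homogeneous d' g \<Longrightarrow> homogeneous (d + d') (f * g)"
  using Poly_Mapping.keys_mult[of f g] by (fastforce simp: homogeneous_def mono_deg_add)

lemma homogeneous_lookup_0: "homogeneous d f \<Longrightarrow> d \<noteq> 0 \<Longrightarrow> Poly_Mapping.lookup f 0 = 0"
  by (force simp: homogeneous_def in_keys_iff)

text \<open>Taking the constant term is evaluation at the origin: a sum of exponent vectors over the
  natural numbers vanishes only if both summands do. Matrices are reduced modulo the maximal ideal
  through this.\<close>

lemma lookup_0_mult:
  fixes f g :: "'a::field mvpoly"
  shows "Poly_Mapping.lookup (f * g) 0 = Poly_Mapping.lookup f 0 * Poly_Mapping.lookup g 0"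
proof -
  have zero: "Poly_Mapping.lookup (h * h') 0 = 0" if "Poly_Mapping.lookup h 0 = 0" for h h' :: "'a mvpoly"
  proof -
    have "0 \<notin> Poly_Mapping.keys (h * h')"
    proof
      assume "0 \<in> Poly_Mapping.keys (h * h')"
      then obtain a b where ab: "0 = a + b" "a \<in> Poly_Mapping.keys h"
        using Poly_Mapping.keys_mult[of h h'] by blast
      have "a = 0"
        using ab(1) by (intro poly_mapping_eqI) (metis add_eq_0_iff_both_eq_0 lookup_add lookup_zero)
      then show False using ab(2) that by (simp add: in_keys_iff)
    qed
    then show ?thesis by (simp add: in_keys_iff)
  qed
  define f' g' where "f' = f - Poly_Mapping.single 0 (Poly_Mapping.lookup f 0)"
    and "g' = g - Poly_Mapping.single 0 (Poly_Mapping.lookup g 0)"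
  have 0: "Poly_Mapping.lookup f' 0 = 0" "Poly_Mapping.lookup g' 0 = 0"
    by (simp_all add: f'_def g'_def lookup_minus)
  have "f * g = f' * g + g' * Poly_Mapping.single 0 (Poly_Mapping.lookup f 0)
      + Poly_Mapping.single 0 (Poly_Mapping.lookup f 0) * Poly_Mapping.single 0 (Poly_Mapping.lookup g 0)"
    by (simp add: f'_def g'_def algebra_simps)
  then show ?thesis
    by (simp add: lookup_add zero[OF 0(1)] zero[OF 0(2)] mult_single)
qed

section \<open>Homogeneous components of a polynomial\<close>

definition hom_component :: "int \<Rightarrow> 'a::field mvpoly \<Rightarrow> 'a mvpoly" where
  "hom_component d f =
     (\<Sum>e | e \<in> Poly_Mapping.keys f \<and> int (mono_deg e) = d. Poly_Mapping.single e (Poly_Mapping.lookup f e))"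

lemma lookup_hom_component:
  "Poly_Mapping.lookup (hom_component d f) e = (if int (mono_deg e) = d then Poly_Mapping.lookup f e else 0)"
proof -
  have "Poly_Mapping.lookup (hom_component d f) e =
    (\<Sum>e' | e' \<in> Poly_Mapping.keys f \<and> int (mono_deg e') = d. if e' = e then Poly_Mapping.lookup f e else 0)"
    unfolding hom_component_def lookup_sum by (rule sum.cong) (auto simp: lookup_single when_def)
  also have "\<dots> = (if int (mono_deg e) = d then Poly_Mapping.lookup f e else 0)"
    by (subst sum.delta) (auto simp: in_keys_iff)
  finally show ?thesis .
qed

lemma keys_hom_component:
  "Poly_Mapping.keys (hom_component d f) = {e \<in> Poly_Mapping.keys f. int (mono_deg e) = d}"
  by (auto simp: in_keys_iff lookup_hom_component split: if_splits)

lemma homogeneous_hom_component [simp]: "homogeneous d (hom_component d f)"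
  by (simp add: homogeneous_def keys_hom_component)

lemma hom_component_in_poly_ring [intro]: "f \<in> poly_ring n \<Longrightarrow> hom_component d f \<in> poly_ring n"
  by (auto simp: poly_ring_def keys_hom_component)

lemma hom_component_id: "homogeneous d f \<Longrightarrow> hom_component d f = f"
  by (rule poly_mapping_eqI) (auto simp: lookup_hom_component homogeneous_def in_keys_iff)

lemma hom_component_zero [simp]: "hom_component d 0 = 0"
  by (rule poly_mapping_eqI) (auto simp: lookup_hom_component)

lemma hom_component_add: "hom_component d (f + g) = hom_component d f + hom_component d g"
  by (rule poly_mapping_eqI) (auto simp: lookup_hom_component lookup_add)

lemma hom_component_sum: "hom_component d (sum f A) = (\<Sum>i\<in>A. hom_component d (f i))"
  by (induction A rule: infinite_finite_induct) (auto simp: hom_component_add)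

text \<open>Once the component of degree \<open>d - a\<close> is removed from \<open>f\<close>, a
  monomial of degree \<open>d\<close> in the product would need a factor of degree
  \<open>d - a\<close> from the remainder, which has none.\<close>

lemma hom_component_mult:
  assumes "homogeneous a g"
  shows "hom_component d (g * f) = g * hom_component (d - a) f"
proof -
  define f' where "f' = f - hom_component (d - a) f"
  have "hom_component d (g * f') = 0"
  proof (rule poly_mapping_eqI)
    fix e
    have "Poly_Mapping.lookup (g * f') e = 0" if e: "int (mono_deg e) = d"
    proof (rule ccontr)
      assume "Poly_Mapping.lookup (g * f') e \<noteq> 0"
      then have "e \<in> Poly_Mapping.keys (g * f')" by (simp add: in_keys_iff)
      then obtain b c where "e = b + c" "b \<in> Poly_Mapping.keys g" "c \<in> Poly_Mapping.keys f'"
        using Poly_Mapping.keys_mult[of g f'] by blast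
      then have "int (mono_deg c) = d - a" and "Poly_Mapping.lookup f' c \<noteq> 0"
        using assms e by (auto simp: homogeneous_def mono_deg_add in_keys_iff)
      then show False by (simp add: f'_def lookup_minus lookup_hom_component)
    qed
    then show "Poly_Mapping.lookup (hom_component d (g * f')) e = Poly_Mapping.lookup 0 e"
      by (simp add: lookup_hom_component)
  qed
  moreover have "homogeneous d (g * hom_component (d - a) f)"
    using homogeneous_mult[OF assms homogeneous_hom_component[of "d - a" f]] by simp
  moreover have "g * f = g * f' + g * hom_component (d - a) f"
    by (simp add: f'_def algebra_simps)
  ultimately show ?thesis
    by (simp add: hom_component_add hom_component_id)
qed

subsection \<open>Matrices\<close>

text \<open>Vectors and matrices are functions on all indices, and only the range of summation is
  given. Membership in \<open>Vec\<close> and \<open>Mats\<close> forces zeros outside of the range,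
  so that equations between matrices are plain equations of functions.\<close>

definition mvec :: "nat \<Rightarrow> (nat \<Rightarrow> nat \<Rightarrow> 'r::comm_ring_1) \<Rightarrow> (nat \<Rightarrow> 'r) \<Rightarrow> nat \<Rightarrow> 'r" where
  "mvec r A v = (\<lambda>a. \<Sum>b<r. A a b * v b)"

definition mmult :: "nat \<Rightarrow> (nat \<Rightarrow> nat \<Rightarrow> 'r::comm_ring_1) \<Rightarrow> (nat \<Rightarrow> nat \<Rightarrow> 'r) \<Rightarrow> nat \<Rightarrow> nat \<Rightarrow> 'r" where
  "mmult r A B = (\<lambda>a c. \<Sum>b<r. A a b * B b c)"

definition unit_mat :: "nat \<Rightarrow> nat \<Rightarrow> nat \<Rightarrow> 'r::comm_ring_1" where
  "unit_mat r = (\<lambda>a b. if a = b \<and> a < r then 1 else 0)"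

definition Vec :: "nat \<Rightarrow> nat \<Rightarrow> (nat \<Rightarrow> 'a::field mvpoly) set" where
  "Vec n r = {v. \<forall>a. v a \<in> poly_ring n \<and> (r \<le> a \<longrightarrow> v a = 0)}"

definition Mats :: "nat \<Rightarrow> nat \<Rightarrow> nat \<Rightarrow> (nat \<Rightarrow> nat \<Rightarrow> 'a::field mvpoly) set" where
  "Mats n r s = {A. \<forall>a b. A a b \<in> poly_ring n \<and> (r \<le> a \<or> s \<le> b \<longrightarrow> A a b = 0)}"

lemma mmult_col: "(\<lambda>a. mmult r A B a c) = mvec r A (\<lambda>b. B b c)"
  by (simp add: mmult_def mvec_def)

lemma mvec_mmult: "mvec s (mmult r A B) v = mvec r A (mvec s B v)"
proof
  fix a
  have "mvec s (mmult r A B) v a = (\<Sum>c<s. \<Sum>b<r. A a b * B b c * v c)"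
    by (simp add: mvec_def mmult_def sum_distrib_right)
  also have "\<dots> = (\<Sum>b<r. \<Sum>c<s. A a b * B b c * v c)" by (rule sum.swap)
  finally show "mvec s (mmult r A B) v a = mvec r A (mvec s B v) a"
    by (simp add: mvec_def sum_distrib_left mult.assoc)
qed

lemma mmult_assoc: "mmult s (mmult r A B) C = mmult r A (mmult s B C)"
proof -
  have "(\<lambda>a. mmult s (mmult r A B) C a c) = (\<lambda>a. mmult r A (mmult s B C) a c)" for c
    unfolding mmult_col mvec_mmult by simp
  then show ?thesis by (metis (no_types) ext)
qed

lemma mmult_zero [simp]: "mmult r (\<lambda>_ _. 0) A = (\<lambda>_ _. 0)" "mmult r A (\<lambda>_ _. 0) = (\<lambda>_ _. 0)"
  by (simp_all add: mmult_def)

lemma mvec_zero [simp]: "mvec r (\<lambda>_ _. 0) v = (\<lambda>_. 0)" "mvec r A (\<lambda>_. 0) = (\<lambda>_. 0)"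
  by (simp_all add: mvec_def)

lemma mmult_diff_left: "mmult r (\<lambda>a b. A a b - B a b) C = (\<lambda>a b. mmult r A C a b - mmult r B C a b)"
  by (simp add: mmult_def left_diff_distrib sum_subtractf)

lemma mmult_diff_right: "mmult r C (\<lambda>a b. A a b - B a b) = (\<lambda>a b. mmult r C A a b - mmult r C B a b)"
  by (simp add: mmult_def right_diff_distrib sum_subtractf)

lemma mvec_add: "mvec r A (\<lambda>b. v b + w b) = (\<lambda>a. mvec r A v a + mvec r A w a)"
  by (simp add: mvec_def distrib_left sum.distrib)

lemma mvec_uminus: "mvec r A (\<lambda>b. - v b) = (\<lambda>a. - mvec r A v a)"
  by (simp add: mvec_def sum_negf)

lemma mvec_unit_mat: "b < r \<Longrightarrow> mvec r A (\<lambda>a. unit_mat r a b) = (\<lambda>a. A a b)"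
  by (simp add: mvec_def unit_mat_def if_distrib cong: if_cong)

lemma mmult_unit_mat_right: "A \<in> Mats n q r \<Longrightarrow> mmult r A (unit_mat r) = A"
  by (auto simp: mmult_def unit_mat_def Mats_def fun_eq_iff if_distrib if_distribR sum.delta cong: if_cong)

lemma mmult_unit_mat_left:
  assumes "A \<in> Mats n r q"
  shows "mmult r (unit_mat r) A = A"
proof (intro ext)
  fix a c
  have "mmult r (unit_mat r) A a c = (\<Sum>b<r. if b = a then A a c else 0)"
    unfolding mmult_def unit_mat_def by (rule sum.cong) auto
  then show "mmult r (unit_mat r) A a c = A a c"
    using assms by (auto simp: Mats_def)
qed

lemma unit_mat_Mats [simp]: "unit_mat r \<in> Mats n r r"
  by (auto simp: Mats_def unit_mat_def)

lemma unit_mat_Vec: "(\<lambda>a. unit_mat r a b) \<in> Vec n r"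
  by (auto simp: Vec_def unit_mat_def)

lemma zero_Mats [simp]: "(\<lambda>_ _. 0) \<in> Mats n r s"
  by (simp add: Mats_def)

lemma zero_Vec [simp]: "(\<lambda>_. 0) \<in> Vec n r"
  by (simp add: Vec_def)

lemma Mats_col: "A \<in> Mats n r s \<Longrightarrow> (\<lambda>a. A a b) \<in> Vec n r"
  by (auto simp: Mats_def Vec_def)

lemma mmult_Mats [intro]: "A \<in> Mats n q r \<Longrightarrow> B \<in> Mats n r s \<Longrightarrow> mmult r A B \<in> Mats n q s"
  by (auto simp: Mats_def mmult_def intro!: poly_ring_sum)

lemma mvec_Vec [intro]: "A \<in> Mats n q r \<Longrightarrow> v \<in> Vec n r \<Longrightarrow> mvec r A v \<in> Vec n q"
  by (auto simp: Mats_def Vec_def mvec_def intro!: poly_ring_sum)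

lemma diff_Mats [intro]: "A \<in> Mats n r s \<Longrightarrow> B \<in> Mats n r s \<Longrightarrow> (\<lambda>a b. A a b - B a b) \<in> Mats n r s"
  by (auto simp: Mats_def)

lemma add_Vec [intro]: "v \<in> Vec n r \<Longrightarrow> w \<in> Vec n r \<Longrightarrow> (\<lambda>a. v a + w a) \<in> Vec n r"
  by (auto simp: Vec_def)

lemma uminus_Vec [intro]: "v \<in> Vec n r \<Longrightarrow> (\<lambda>a. - v a) \<in> Vec n r"
  by (auto simp: Vec_def)

lemma mmult_lookup_0:
  "Poly_Mapping.lookup (mmult r A B a c) 0 =
     (\<Sum>b<r. Poly_Mapping.lookup (A a b) 0 * Poly_Mapping.lookup (B b c) (0 :: nat \<Rightarrow>\<^sub>0 nat))"
  for A B :: "nat \<Rightarrow> nat \<Rightarrow> 'a::field mvpoly"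
  by (simp add: mmult_def lookup_sum lookup_0_mult)

text \<open>Free modules are projective: a preimage chosen for each column of \<open>A\<close> gives
  the columns of the factor.\<close>

lemma lift_columns:
  assumes A: "A \<in> Mats n r s"
    and im: "\<And>c. c < s \<Longrightarrow> \<exists>w\<in>Vec n q. (\<lambda>a. A a c) = mvec q N w"
  obtains B where "B \<in> Mats n q s" "A = mmult q N B"
proof -
  obtain W where W: "\<And>c. c < s \<Longrightarrow> W c \<in> Vec n q" "\<And>c. c < s \<Longrightarrow> (\<lambda>a. A a c) = mvec q N (W c)"
    using im by metis
  define B where "B = (\<lambda>b c. if c < s then W c b else 0)"
  have "B \<in> Mats n q s"
    using W(1) by (auto simp: B_def Mats_def Vec_def)
  moreover have "(\<lambda>a. A a c) = (\<lambda>a. mmult q N B a c)" for c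
  proof (cases "c < s")
    case True
    then show ?thesis by (simp add: mmult_col B_def W(2))
  next
    case False
    then show ?thesis using A by (auto simp: mmult_col B_def Mats_def)
  qed
  then have "A = mmult q N B" by (metis (no_types) ext)
  ultimately show ?thesis by (rule that)
qed

text \<open>Each entry of \<open>B\<close> is replaced by its component of the degree that the
  grading prescribes. Multiplication by the homogeneous entries of \<open>N\<close> is compatible
  with this, so the product is still \<open>A\<close>.\<close>

lemma homogenize_factor:
  assumes B: "B \<in> Mats n q s" "A = mmult q N B"
    and A: "\<And>a c. homogeneous (e c - dg a) (A a c)"
    and N: "\<And>a b. homogeneous (dg' b - dg a) (N a b)"
  obtains B' where "B' \<in> Mats n q s" "A = mmult q N B'" "\<And>b c. homogeneous (e c - dg' b) (B' b c)"
proof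
  define B' where "B' = (\<lambda>b c. hom_component (e c - dg' b) (B b c))"
  show "B' \<in> Mats n q s"
    using B(1) by (auto simp: B'_def Mats_def)
  show "homogeneous (e c - dg' b) (B' b c)" for b c
    by (simp add: B'_def)
  show "A = mmult q N B'"
  proof (intro ext)
    fix a c
    have "A a c = hom_component (e c - dg a) (\<Sum>b<q. N a b * B b c)"
      using hom_component_id[OF A, of c a] by (simp add: B(2) mmult_def)
    also have "\<dots> = mmult q N B' a c"
      by (simp add: hom_component_sum hom_component_mult[OF N] mmult_def B'_def)
    finally show "A a c = mmult q N B' a c" .
  qed
qed

lemma homogeneous_mmult:
  assumes "\<And>a b. homogeneous (f b - e a) (A a b)" "\<And>b c. homogeneous (g c - f b) (B b c)"
  shows "homogeneous (g c - e a) (mmult q A B a c)"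
  unfolding mmult_def
proof (rule homogeneous_sum)
  fix b show "homogeneous (g c - e a) (A a b * B b c)"
    using homogeneous_mult[OF assms(1)[of b a] assms(2)[of c b]] by (simp add: algebra_simps)
qed

text \<open>The identity on a space of dimension \<open>card S\<close> factors through one of
  dimension \<open>card T\<close>. If the latter were smaller, padding would give square matrices
  that are inverse to each other in one order, hence in both, although one of them has a zero
  row.\<close>

lemma delta_factorization_card_le:
  fixes f g :: "nat \<Rightarrow> nat \<Rightarrow> 'a::field"
  assumes fin: "finite S" "finite T"
    and eq: "\<And>b b'. b \<in> S \<Longrightarrow> b' \<in> S \<Longrightarrow> (\<Sum>a\<in>T. f b a * g a b') = (if b = b' then 1 else 0)"
  shows "card S \<le> card T"
proof (rule ccontr)
  assume "\<not> card S \<le> card T"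
  then have less: "card T < card S" by simp
  define N where "N = card S"
  obtain \<sigma> where \<sigma>: "bij_betw \<sigma> {0..<N} S" using fin(1) N_def ex_bij_betw_nat_finite by blast
  obtain \<tau> where \<tau>: "bij_betw \<tau> {0..<card T} T" using fin(2) ex_bij_betw_nat_finite by blast
  define A where "A = mat N N (\<lambda>(i, j). if j < card T then f (\<sigma> i) (\<tau> j) else 0)"
  define B where "B = mat N N (\<lambda>(i, j). if i < card T then g (\<tau> i) (\<sigma> j) else 0)"
  have AB: "A \<in> carrier_mat N N" "B \<in> carrier_mat N N" by (simp_all add: A_def B_def)
  have "A * B = 1\<^sub>m N"
  proof (rule eq_matI)
    fix i j assume "i < dim_row (1\<^sub>m N :: 'a mat)" "j < dim_col (1\<^sub>m N :: 'a mat)"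
    then have ij: "i < N" "j < N" by auto
    have "(A * B) $$ (i, j) = (\<Sum>c\<in>{0..<N}. if c < card T then f (\<sigma> i) (\<tau> c) * g (\<tau> c) (\<sigma> j) else 0)"
      using ij by (auto simp: A_def B_def scalar_prod_def intro!: sum.cong)
    also have "\<dots> = (\<Sum>c\<in>{0..<card T}. f (\<sigma> i) (\<tau> c) * g (\<tau> c) (\<sigma> j))"
      using less by (intro sum.mono_neutral_cong_right) (auto simp: N_def)
    also have "\<dots> = (\<Sum>a\<in>T. f (\<sigma> i) a * g a (\<sigma> j))"
      by (rule sum.reindex_bij_betw[OF \<tau>])
    also have "\<dots> = (if i = j then 1 else 0)"
    proof -
      have "\<sigma> i \<in> S" "\<sigma> j \<in> S" "\<sigma> i = \<sigma> j \<longleftrightarrow> i = j"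
        using \<sigma> ij by (auto simp: bij_betw_def inj_on_def)
      then show ?thesis by (simp add: eq)
    qed
    finally show "(A * B) $$ (i, j) = 1\<^sub>m N $$ (i, j)" using ij by simp
  qed (auto simp: A_def B_def)
  then have BA: "B * A = 1\<^sub>m N"
    using mat_mult_left_right_inverse[OF AB] by blast
  have lt: "card T < N" using less by (simp add: N_def)
  \<comment> \<open>Row \<open>card T\<close> of \<open>B\<close> consists of padding.\<close>
  have "(B * A) $$ (card T, card T) = 0"
    using lt by (simp add: A_def B_def scalar_prod_def)
  then show False using lt BA by simp
qed

subsection \<open>Graded resolutions\<close>

text \<open>This is a resolution of \<open>R/J\<close> with \<open>F_0 = R\<close>, so its indices are those of
  \<open>minimal_graded_free_resolution\<close> shifted by one.\<close>

locale graded_res =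
  fixes n :: nat and J :: "'a::field mvpoly set"
    and r :: "nat \<Rightarrow> nat" and dg :: "nat \<Rightarrow> nat \<Rightarrow> int" and M :: "nat \<Rightarrow> nat \<Rightarrow> nat \<Rightarrow> 'a mvpoly"
  assumes rank_0: "r 0 = 1" and dg_0: "dg 0 0 = 0"
    and M_Mats: "\<And>i. M i \<in> Mats n (r i) (r (Suc i))"
    and M_homogeneous: "\<And>i a b. homogeneous (dg (Suc i) b - dg i a) (M i a b)"
    and image_0: "{mvec (r 1) (M 0) v 0 | v. v \<in> Vec n (r 1)} = J"
    and complex: "\<And>i. mmult (r (Suc i)) (M i) (M (Suc i)) = (\<lambda>_ _. 0)"
    and exact: "\<And>i v. v \<in> Vec n (r (Suc i)) \<Longrightarrow> mvec (r (Suc i)) (M i) v = (\<lambda>_. 0) \<Longrightarrow>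
          \<exists>w\<in>Vec n (r (Suc (Suc i))). v = mvec (r (Suc (Suc i))) (M (Suc i)) w"
begin

abbreviation bd :: "nat \<Rightarrow> (nat \<Rightarrow> 'a mvpoly) \<Rightarrow> nat \<Rightarrow> 'a mvpoly" where
  "bd i \<equiv> mvec (r (Suc i)) (M i)"

lemma bd_bd: "bd i (bd (Suc i) v) = (\<lambda>_. 0)"
  by (simp add: mvec_mmult[symmetric] complex)

lemma bd_0_outside: "0 < a \<Longrightarrow> bd 0 v a = 0"
  using M_Mats[of 0] by (auto simp: mvec_def Mats_def rank_0)

lemma bd_0_mem: "v \<in> Vec n (r 1) \<Longrightarrow> bd 0 v 0 \<in> J"
  using image_0 by auto

lemma mem_bd_0:
  assumes "f \<in> J"
  shows "\<exists>v\<in>Vec n (r 1). bd 0 v = (\<lambda>a. if a = 0 then f else 0)"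
proof -
  obtain v where v: "v \<in> Vec n (r 1)" "bd 0 v 0 = f"
    using assms image_0 by auto
  have "bd 0 v = (\<lambda>a. if a = 0 then f else 0)"
    using v(2) bd_0_outside by auto
  with v(1) show ?thesis by blast
qed

text \<open>The map \<open>h i\<close> goes from \<open>F_i\<close> to \<open>F_(i+1)\<close> and is
  built degree by degree: what remains of \<open>T (Suc i)\<close> after subtracting the composite
  of \<open>h i\<close> and \<open>M i\<close> consists of cycles, and exactness lifts it through
  \<open>M (Suc i)\<close>.\<close>

lemma null_homotopy:
  assumes T: "\<And>i. T i \<in> Mats n (r i) (r i)"
    and chain: "\<And>i. mmult (r i) (T i) (M i) = mmult (r (Suc i)) (M i) (T (Suc i))"
    and T0: "T 0 = (\<lambda>_ _. 0)"
  obtains h where "\<And>i. h i \<in> Mats n (r (Suc i)) (r i)" "h 0 = (\<lambda>_ _. 0)"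
    "\<And>i. T (Suc i) = (\<lambda>a b. mmult (r (Suc (Suc i))) (M (Suc i)) (h (Suc i)) a b + mmult (r i) (h i) (M i) a b)"
proof -
  \<comment> \<open>\<open>A i h\<close> is the remainder that \<open>h (Suc i)\<close> has to
    account for, and \<open>Q\<close> records that its columns are cycles.\<close>
  define A where "A = (\<lambda>i h. \<lambda>a b. T (Suc i) a b - mmult (r i) h (M i) a b)"
  define Q where "Q = (\<lambda>i h. h \<in> Mats n (r (Suc i)) (r i) \<and> (i = 0 \<longrightarrow> h = (\<lambda>_ _. 0)) \<and>
      mmult (r (Suc i)) (M i) (A i h) = (\<lambda>_ _. 0))"
  define R where "R = (\<lambda>i h h'. A i h = mmult (r (Suc (Suc i))) (M (Suc i)) h')"
  have "\<exists>h. \<forall>i. Q i (h i) \<and> R i (h i) (h (Suc i))"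
  proof (rule dependent_nat_choice)
    show "\<exists>h. Q 0 h"
      by (rule exI[where x = "\<lambda>_ _. 0"]) (simp add: Q_def A_def chain[symmetric] T0)
  next
    fix h i assume Q: "Q i h"
    then have h: "h \<in> Mats n (r (Suc i)) (r i)" by (simp add: Q_def)
    have A: "A i h \<in> Mats n (r (Suc i)) (r (Suc i))"
      unfolding A_def using T h M_Mats by blast
    have "\<exists>w\<in>Vec n (r (Suc (Suc i))). (\<lambda>a. A i h a c) = bd (Suc i) w" for c
    proof (rule exact)
      show "(\<lambda>a. A i h a c) \<in> Vec n (r (Suc i))" using A by (rule Mats_col)
      show "bd i (\<lambda>a. A i h a c) = (\<lambda>_. 0)"
        using Q by (simp add: mmult_col[symmetric] Q_def)
    qed
    then obtain h' where h': "h' \<in> Mats n (r (Suc (Suc i))) (r (Suc i))"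
      "A i h = mmult (r (Suc (Suc i))) (M (Suc i)) h'"
      using lift_columns[OF A] by metis
    have A': "A (Suc i) h' = (\<lambda>a b. T (Suc (Suc i)) a b - mmult (r (Suc i)) h' (M (Suc i)) a b)"
      by (simp add: A_def)
    \<comment> \<open>Substituting \<open>A i h\<close> for the product of \<open>M (Suc i)\<close>
      and \<open>h'\<close> leaves \<open>h\<close> followed by two consecutive differentials, which
      compose to zero.\<close>
    have "mmult (r (Suc (Suc i))) (M (Suc i)) (A (Suc i) h') =
        (\<lambda>a b. mmult (r (Suc i)) (T (Suc i)) (M (Suc i)) a b
          - mmult (r (Suc i)) (A i h) (M (Suc i)) a b)"
      by (simp add: A' mmult_diff_right chain h'(2) mmult_assoc)
    also have "\<dots> = (\<lambda>_ _. 0)"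
      by (simp add: A_def mmult_diff_left mmult_assoc complex)
    finally have "Q (Suc i) h'"
      using h'(1) by (simp add: Q_def)
    with h'(2) show "\<exists>h'. Q (Suc i) h' \<and> R i h h'" by (auto simp: R_def)
  qed
  then obtain h where h: "\<And>i. Q i (h i)" "\<And>i. R i (h i) (h (Suc i))" by blast
  show ?thesis
  proof (rule that)
    show "h i \<in> Mats n (r (Suc i)) (r i)" for i using h(1)[of i] by (simp add: Q_def)
    show "h 0 = (\<lambda>_ _. 0)" using h(1)[of 0] by (simp add: Q_def)
    show "T (Suc i) = (\<lambda>a b. mmult (r (Suc (Suc i))) (M (Suc i)) (h (Suc i)) a b + mmult (r i) (h i) (M i) a b)" for i
      using h(2)[of i] by (simp add: R_def A_def fun_eq_iff algebra_simps)
  qed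
qed

end

section \<open>Comparison maps and invariance of the ranks\<close>

definition corner :: "'a::field mvpoly \<Rightarrow> nat \<Rightarrow> nat \<Rightarrow> 'a mvpoly" where
  "corner g = (\<lambda>a b. if a = 0 \<and> b = 0 then g else 0)"

lemma corner_Mats [intro]: "g \<in> poly_ring n \<Longrightarrow> corner g \<in> Mats n 1 1"
  by (auto simp: corner_def Mats_def)

lemma mvec_corner: "mvec 1 (corner g) v = (\<lambda>a. if a = 0 then g * v 0 else 0)"
  by (auto simp: mvec_def corner_def)

text \<open>The comparison theorem: multiplication by \<open>g\<close> from \<open>R/J'\<close> to
  \<open>R/J\<close> lifts to the resolutions as a map of degree \<open>sh\<close>. Each lift is
  found column by column and then made homogeneous.\<close>

lemma chain_lift:
  fixes g :: "'a::field mvpoly"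
  assumes F: "graded_res n J r dg M" and G: "graded_res n J' r' dg' M'"
    and g: "g \<in> poly_ring n" "homogeneous sh g" "\<And>f. f \<in> J' \<Longrightarrow> g * f \<in> J"
  obtains \<phi> where "\<And>i. \<phi> i \<in> Mats n (r i) (r' i)" "\<phi> 0 = corner g"
    "\<And>i a b. homogeneous (dg' i b + sh - dg i a) (\<phi> i a b)"
    "\<And>i. mmult (r' i) (\<phi> i) (M' i) = mmult (r (Suc i)) (M i) (\<phi> (Suc i))"
proof -
  interpret F: graded_res n J r dg M by (rule F)
  interpret G: graded_res n J' r' dg' M' by (rule G)
  \<comment> \<open>The last conjunct keeps the induction going: boundaries are sent to boundaries.
    In degree \<open>0\<close> this comes from multiplication by \<open>g\<close> mapping
    \<open>J'\<close> into \<open>J\<close>, afterwards from exactness.\<close>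
  define Q where "Q = (\<lambda>i \<phi>. \<phi> \<in> Mats n (r i) (r' i) \<and> (i = 0 \<longrightarrow> \<phi> = corner g) \<and>
      (\<forall>a b. homogeneous (dg' i b + sh - dg i a) (\<phi> a b)) \<and>
      (\<forall>v\<in>Vec n (r' (Suc i)). \<exists>w\<in>Vec n (r (Suc i)). mvec (r' i) \<phi> (G.bd i v) = F.bd i w))"
  define R where "R = (\<lambda>i \<phi> \<psi>. mmult (r' i) \<phi> (M' i) = mmult (r (Suc i)) (M i) \<psi>)"
  have "\<exists>\<phi>. \<forall>i. Q i (\<phi> i) \<and> R i (\<phi> i) (\<phi> (Suc i))"
  proof (rule dependent_nat_choice)
    have "\<exists>w\<in>Vec n (r (Suc 0)). mvec (r' 0) (corner g) (G.bd 0 v) = F.bd 0 w"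
      if v: "v \<in> Vec n (r' (Suc 0))" for v
    proof -
      have "g * G.bd 0 v 0 \<in> J" using v G.bd_0_mem g(3) by simp
      then obtain w where "w \<in> Vec n (r 1)" "F.bd 0 w = (\<lambda>a. if a = 0 then g * G.bd 0 v 0 else 0)"
        using F.mem_bd_0 by blast
      then show ?thesis
        unfolding G.rank_0 mvec_corner by (metis One_nat_def)
    qed
    moreover have "corner g \<in> Mats n (r 0) (r' 0)"
      unfolding F.rank_0 G.rank_0 by (rule corner_Mats[OF g(1)])
    moreover have "homogeneous (dg' 0 b + sh - dg 0 a) (corner g a b)" for a b
      using g(2) by (simp add: corner_def F.dg_0 G.dg_0)
    ultimately have "Q 0 (corner g)"
      unfolding Q_def by blast
    then show "\<exists>\<phi>. Q 0 \<phi>" by blast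
  next
    fix \<phi> i assume Q: "Q i \<phi>"
    then have \<phi>: "\<phi> \<in> Mats n (r i) (r' i)" "\<And>a b. homogeneous (dg' i b + sh - dg i a) (\<phi> a b)"
      and im: "\<And>v. v \<in> Vec n (r' (Suc i)) \<Longrightarrow> \<exists>w\<in>Vec n (r (Suc i)). mvec (r' i) \<phi> (G.bd i v) = F.bd i w"
      by (auto simp: Q_def)
    define A where "A = mmult (r' i) \<phi> (M' i)"
    have A: "A \<in> Mats n (r i) (r' (Suc i))" unfolding A_def using \<phi>(1) G.M_Mats by blast
    have A_hom: "homogeneous ((dg' (Suc i) c + sh) - dg i a) (A a c)" for a c
      unfolding A_def
    proof (rule homogeneous_mmult[where f = "\<lambda>b. dg' i b + sh" and g = "\<lambda>c. dg' (Suc i) c + sh"])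
      show "homogeneous (dg' i b + sh - dg i a) (\<phi> a b)" for a b by (rule \<phi>(2))
      show "homogeneous (dg' (Suc i) c + sh - (dg' i b + sh)) (M' i b c)" for b c
        using G.M_homogeneous[of i c b] by simp
    qed
    have "\<exists>w\<in>Vec n (r (Suc i)). (\<lambda>a. A a c) = F.bd i w" if c: "c < r' (Suc i)" for c
    proof -
      have "(\<lambda>a. A a c) = mvec (r' i) \<phi> (G.bd i (\<lambda>a. unit_mat (r' (Suc i)) a c))"
        by (simp add: A_def mmult_col mvec_unit_mat[OF c])
      then show ?thesis using im[OF unit_mat_Vec] by simp
    qed
    then obtain B where B: "B \<in> Mats n (r (Suc i)) (r' (Suc i))" "A = mmult (r (Suc i)) (M i) B"
      using lift_columns[OF A] by blast
    obtain \<psi> where \<psi>: "\<psi> \<in> Mats n (r (Suc i)) (r' (Suc i))" "A = mmult (r (Suc i)) (M i) \<psi>"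
      "\<And>b c. homogeneous ((dg' (Suc i) c + sh) - dg (Suc i) b) (\<psi> b c)"
      by (rule homogenize_factor[where e = "\<lambda>c. dg' (Suc i) c + sh" and dg = "dg i" and dg' = "dg (Suc i)",
            OF B A_hom F.M_homogeneous]) (rule that)
    have "\<exists>w\<in>Vec n (r (Suc (Suc i))). mvec (r' (Suc i)) \<psi> (G.bd (Suc i) v) = F.bd (Suc i) w"
      if v: "v \<in> Vec n (r' (Suc (Suc i)))" for v
    proof (rule F.exact)
      show "mvec (r' (Suc i)) \<psi> (G.bd (Suc i) v) \<in> Vec n (r (Suc i))"
        using \<psi>(1) v G.M_Mats by blast
      have "F.bd i (mvec (r' (Suc i)) \<psi> (G.bd (Suc i) v)) = mvec (r' (Suc i)) A (G.bd (Suc i) v)"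
        by (simp add: \<psi>(2) mvec_mmult)
      also have "\<dots> = (\<lambda>_. 0)" by (simp add: A_def mvec_mmult G.bd_bd)
      finally show "F.bd i (mvec (r' (Suc i)) \<psi> (G.bd (Suc i) v)) = (\<lambda>_. 0)" .
    qed
    then have "Q (Suc i) \<psi>" using \<psi> by (simp add: Q_def)
    then show "\<exists>\<psi>. Q (Suc i) \<psi> \<and> R i \<phi> \<psi>" using \<psi>(2) by (auto simp: R_def A_def)
  qed
  then obtain \<phi> where \<phi>: "\<And>i. Q i (\<phi> i)" "\<And>i. R i (\<phi> i) (\<phi> (Suc i))" by blast
  show ?thesis
  proof (rule that)
    show "\<phi> i \<in> Mats n (r i) (r' i)" for i using \<phi>(1)[of i] by (simp add: Q_def)
    show "\<phi> 0 = corner g" using \<phi>(1)[of 0] by (simp add: Q_def)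
    show "homogeneous (dg' i b + sh - dg i a) (\<phi> i a b)" for i a b using \<phi>(1)[of i] by (simp add: Q_def)
    show "mmult (r' i) (\<phi> i) (M' i) = mmult (r (Suc i)) (M i) (\<phi> (Suc i))" for i
      using \<phi>(2)[of i] by (simp add: R_def)
  qed
qed

text \<open>The composite of the comparison maps \<phi> and \<psi> is homotopic to the identity of
  the resolution \<open>M\<close>. Modulo the maximal ideal the homotopy terms vanish by minimality,
  so the constant parts of \<psi> and \<phi> factor an identity matrix, separately in each degree
  \<open>j\<close>.\<close>

lemma betti_le:
  assumes F: "graded_res n J r dg M" and G: "graded_res n J r' dg' M'"
    and min: "\<And>i a b. Poly_Mapping.lookup (M (Suc i) a b) 0 = 0"
  shows "card {a. a < r (Suc i) \<and> dg (Suc i) a = j} \<le> card {a. a < r' (Suc i) \<and> dg' (Suc i) a = j}"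
proof -
  interpret F: graded_res n J r dg M by (rule F)
  interpret G: graded_res n J r' dg' M' by (rule G)
  obtain \<phi> where \<phi>: "\<And>i. \<phi> i \<in> Mats n (r' i) (r i)" "\<phi> 0 = corner 1"
    "\<And>i a b. homogeneous (dg i b + 0 - dg' i a) (\<phi> i a b)"
    "\<And>i. mmult (r i) (\<phi> i) (M i) = mmult (r' (Suc i)) (M' i) (\<phi> (Suc i))"
    by (rule chain_lift[OF G F, of 1 0]) auto
  obtain \<psi> where \<psi>: "\<And>i. \<psi> i \<in> Mats n (r i) (r' i)" "\<psi> 0 = corner 1"
    "\<And>i a b. homogeneous (dg' i b + 0 - dg i a) (\<psi> i a b)"
    "\<And>i. mmult (r' i) (\<psi> i) (M' i) = mmult (r (Suc i)) (M i) (\<psi> (Suc i))"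
    by (rule chain_lift[OF F G, of 1 0]) auto
  define T where "T = (\<lambda>i a b. mmult (r' i) (\<psi> i) (\<phi> i) a b - unit_mat (r i) a b)"
  have T: "T i \<in> Mats n (r i) (r i)" for i
    unfolding T_def using \<phi>(1) \<psi>(1) unit_mat_Mats by blast
  have "mmult (r i) (mmult (r' i) (\<psi> i) (\<phi> i)) (M i) =
      mmult (r (Suc i)) (M i) (mmult (r' (Suc i)) (\<psi> (Suc i)) (\<phi> (Suc i)))" for i
    by (simp add: mmult_assoc \<phi>(4)) (simp add: mmult_assoc[symmetric] \<psi>(4))
  then have chain: "mmult (r i) (T i) (M i) = mmult (r (Suc i)) (M i) (T (Suc i))" for i
    using mmult_unit_mat_left[OF F.M_Mats] mmult_unit_mat_right[OF F.M_Mats]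
    by (simp add: T_def mmult_diff_left mmult_diff_right)
  have T0: "T 0 = (\<lambda>_ _. 0)"
    by (auto simp: T_def \<phi>(2) \<psi>(2) F.rank_0 G.rank_0 mmult_def corner_def unit_mat_def fun_eq_iff)
  obtain h where h: "\<And>i. h i \<in> Mats n (r (Suc i)) (r i)" "h 0 = (\<lambda>_ _. 0)"
    "\<And>i. T (Suc i) = (\<lambda>a b. mmult (r (Suc (Suc i))) (M (Suc i)) (h (Suc i)) a b + mmult (r i) (h i) (M i) a b)"
    by (rule F.null_homotopy[OF T chain T0]) blast
  \<comment> \<open>For \<open>i = 0\<close> this rests on \<open>h 0 = 0\<close>, because
    \<open>min\<close> does not cover \<open>M 0\<close>.\<close>
  have "Poly_Mapping.lookup (mmult (r i) (h i) (M i) a b) 0 = 0" for a b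
    using h(2) min by (cases i) (auto simp: mmult_lookup_0)
  then have "Poly_Mapping.lookup (T (Suc i) a b) 0 = 0" for a b
    using min by (simp add: h(3) lookup_add mmult_lookup_0)
  then have const: "Poly_Mapping.lookup (mmult (r' (Suc i)) (\<psi> (Suc i)) (\<phi> (Suc i)) a b) 0 =
      Poly_Mapping.lookup (unit_mat (r (Suc i)) a b :: 'a mvpoly) 0" for a b
    by (simp add: T_def lookup_minus)
  let ?T = "{a. a < r' (Suc i) \<and> dg' (Suc i) a = j}"
  show ?thesis
  proof (rule delta_factorization_card_le)
    fix b b' assume b: "b \<in> {a. a < r (Suc i) \<and> dg (Suc i) a = j}"
      and b': "b' \<in> {a. a < r (Suc i) \<and> dg (Suc i) a = j}"
    have "(\<Sum>a\<in>?T. Poly_Mapping.lookup (\<psi> (Suc i) b a) 0 * Poly_Mapping.lookup (\<phi> (Suc i) a b') 0) =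
        (\<Sum>a<r' (Suc i). Poly_Mapping.lookup (\<psi> (Suc i) b a) 0 * Poly_Mapping.lookup (\<phi> (Suc i) a b') 0)"
    \<comment> \<open>Only basis elements of the same degree contribute: a homogeneous entry of
      nonzero degree has no constant term.\<close>
    proof (rule sum.mono_neutral_left)
      show "\<forall>a\<in>{..<r' (Suc i)} - ?T.
          Poly_Mapping.lookup (\<psi> (Suc i) b a) 0 * Poly_Mapping.lookup (\<phi> (Suc i) a b') 0 = 0"
        using b homogeneous_lookup_0[OF \<psi>(3)] by auto
    qed auto
    also have "\<dots> = (if b = b' then 1 else 0)"
      using b by (simp add: mmult_lookup_0[symmetric] const) (auto simp: unit_mat_def)
    finally show "(\<Sum>a\<in>?T. Poly_Mapping.lookup (\<psi> (Suc i) b a) 0 * Poly_Mapping.lookup (\<phi> (Suc i) a b') 0) =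
        (if b = b' then 1 else 0)" .
  qed auto
qed

subsection \<open>The mapping cone\<close>

definition vec_append :: "nat \<Rightarrow> (nat \<Rightarrow> 'r) \<Rightarrow> (nat \<Rightarrow> 'r) \<Rightarrow> nat \<Rightarrow> 'r" where
  "vec_append p v w = (\<lambda>a. if a < p then v a else w (a - p))"

lemma vec_append_Vec: "v \<in> Vec n p \<Longrightarrow> w \<in> Vec n q \<Longrightarrow> vec_append p v w \<in> Vec n (p + q)"
  by (auto simp: Vec_def vec_append_def)

lemma vec_append_zero [simp]: "vec_append p (\<lambda>_. 0) (\<lambda>_. 0) = (\<lambda>_. 0)"
  by (auto simp: vec_append_def)

lemma vec_append_eq_zero:
  assumes "v \<in> Vec n p" "vec_append p v w = (\<lambda>_. 0)"
  shows "v = (\<lambda>_. 0)" "w = (\<lambda>_. 0)"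
proof -
  have "v a = 0" for a
    using assms(1) fun_cong[OF assms(2), of a] by (cases "a < p") (auto simp: vec_append_def Vec_def)
  then show "v = (\<lambda>_. 0)" by blast
  have "w a = 0" for a
    using fun_cong[OF assms(2), of "p + a"] by (simp add: vec_append_def)
  then show "w = (\<lambda>_. 0)" by blast
qed

lemma Vec_append_cases:
  assumes "x \<in> Vec n (p + q)"
  obtains v w where "v \<in> Vec n p" "w \<in> Vec n q" "x = vec_append p v w"
proof
  show "(\<lambda>a. if a < p then x a else 0) \<in> Vec n p" "(\<lambda>a. x (p + a)) \<in> Vec n q"
    using assms by (auto simp: Vec_def)
qed (auto simp: vec_append_def)

lemma sum_lessThan_add: "(\<Sum>b<p + q. f b) = (\<Sum>b<p. f b) + (\<Sum>b<q. f (p + b))"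
  for f :: "nat \<Rightarrow> 'b::comm_monoid_add"
  by (induction q) (auto simp: add.assoc)

lemma Mats_eq_zeroI:
  assumes A: "A \<in> Mats n r s" and zero: "\<And>v. v \<in> Vec n s \<Longrightarrow> mvec s A v = (\<lambda>_. 0)"
  shows "A = (\<lambda>_ _. 0)"
proof (intro ext)
  fix a b
  show "A a b = 0"
  proof (cases "b < s")
    case True
    then show ?thesis
      using zero[OF unit_mat_Vec, of b] by (simp add: mvec_unit_mat fun_eq_iff)
  qed (use A in \<open>auto simp: Mats_def\<close>)
qed

locale chain_map = F: graded_res n J r dg M + G: graded_res n J' r' dg' M'
  for n and J :: "'a::field mvpoly set" and r dg M and J' :: "'a mvpoly set" and r' dg' M' +
  fixes sh :: int and u :: "'a mvpoly" and \<phi> :: "nat \<Rightarrow> nat \<Rightarrow> nat \<Rightarrow> 'a mvpoly"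
  assumes \<phi>_Mats: "\<And>i. \<phi> i \<in> Mats n (r i) (r' i)"
    and \<phi>_0: "\<phi> 0 = corner u"
    and \<phi>_homogeneous: "\<And>i a b. homogeneous (dg' i b + sh - dg i a) (\<phi> i a b)"
    and \<phi>_chain: "\<And>i. mmult (r' i) (\<phi> i) (M' i) = mmult (r (Suc i)) (M i) (\<phi> (Suc i))"
begin

text \<open>The cone of \<phi> has the target of \<phi> in degree \<open>i\<close> and its source
  moved up by one; \<open>cone_dg\<close> also shifts the degrees of the source by
  \<open>sh\<close>. Degree \<open>0\<close> has no part from the source and is just
  \<open>R\<close>.\<close>

definition cone_rank :: "nat \<Rightarrow> nat" where
  "cone_rank i = (case i of 0 \<Rightarrow> 1 | Suc k \<Rightarrow> r (Suc k) + r' k)"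

definition cone_dg :: "nat \<Rightarrow> nat \<Rightarrow> int" where
  "cone_dg i a = (case i of 0 \<Rightarrow> dg 0 a
     | Suc k \<Rightarrow> if a < r (Suc k) then dg (Suc k) a else dg' k (a - r (Suc k)) + sh)"

text \<open>In block form the rows are \<open>(M i, \<phi> i)\<close> and
  \<open>(0, - M' (i - 1))\<close>; the sign makes the two contributions of \<phi> to the square
  cancel. For \<open>i = 0\<close> only the first row is left.\<close>

definition cone_M :: "nat \<Rightarrow> nat \<Rightarrow> nat \<Rightarrow> 'a mvpoly" where
  "cone_M i a b = (case i of
     0 \<Rightarrow> if b < r 1 then M 0 a b else \<phi> 0 a (b - r 1)
   | Suc k \<Rightarrow>
       if a < r i then if b < r (Suc i) then M i a b else \<phi> i a (b - r (Suc i))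
       else if b < r (Suc i) then 0 else - M' k (a - r i) (b - r (Suc i)))"

abbreviation cone_bd where "cone_bd i \<equiv> mvec (cone_rank (Suc i)) (cone_M i)"

lemma \<phi>_bd: "mvec (r' i) (\<phi> i) (G.bd i v) = F.bd i (mvec (r' (Suc i)) (\<phi> (Suc i)) v)"
  by (simp add: mvec_mmult[symmetric] \<phi>_chain)

lemma cone_Mats: "cone_M i \<in> Mats n (cone_rank i) (cone_rank (Suc i))"
proof -
  have "\<forall>i a b. M i a b \<in> poly_ring n \<and> (r i \<le> a \<or> r (Suc i) \<le> b \<longrightarrow> M i a b = 0)"
    "\<forall>i a b. M' i a b \<in> poly_ring n \<and> (r' i \<le> a \<or> r' (Suc i) \<le> b \<longrightarrow> M' i a b = 0)"
    "\<forall>i a b. \<phi> i a b \<in> poly_ring n \<and> (r i \<le> a \<or> r' i \<le> b \<longrightarrow> \<phi> i a b = 0)"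
    using F.M_Mats G.M_Mats \<phi>_Mats by (auto simp: Mats_def)
  then show ?thesis
    using F.rank_0 by (cases i) (auto simp: Mats_def cone_M_def cone_rank_def)
qed

lemma cone_homogeneous: "homogeneous (cone_dg (Suc i) b - cone_dg i a) (cone_M i a b)"
proof (cases i)
  case 0
  then show ?thesis
    using F.M_homogeneous[of 0 b a] \<phi>_homogeneous[of 0 "b - r 1" a]
    by (auto simp: cone_dg_def cone_M_def)
next
  case (Suc k)
  then show ?thesis
    using F.M_homogeneous[of i b a] \<phi>_homogeneous[of i "b - r (Suc i)" a]
      G.M_homogeneous[of k "b - r (Suc i)" "a - r i"]
    by (auto simp: cone_dg_def cone_M_def algebra_simps)
qed

lemma cone_bd_0:
  "cone_bd 0 (vec_append (r 1) v w) = (\<lambda>a. F.bd 0 v a + mvec (r' 0) (\<phi> 0) w a)"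
  by (simp add: mvec_def cone_rank_def sum_lessThan_add cone_M_def vec_append_def)

lemma cone_bd_Suc:
  "cone_bd (Suc i) (vec_append (r (Suc (Suc i))) v w) =
     vec_append (r (Suc i)) (\<lambda>a. F.bd (Suc i) v a + mvec (r' (Suc i)) (\<phi> (Suc i)) w a)
       (\<lambda>a. - G.bd i w a)"
  by (rule ext) (simp add: mvec_def cone_rank_def sum_lessThan_add cone_M_def vec_append_def sum_negf)

lemma cone_rank_Suc: "cone_rank (Suc i) = r (Suc i) + r' i"
  by (simp add: cone_rank_def)

lemma cone_bd_bd:
  assumes "x \<in> Vec n (cone_rank (Suc (Suc i)))"
  shows "cone_bd i (cone_bd (Suc i) x) = (\<lambda>_. 0)"
proof -
  obtain v w where x: "x = vec_append (r (Suc (Suc i))) v w"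
    using assms unfolding cone_rank_Suc by (rule Vec_append_cases)
  have "F.bd i (\<lambda>a. F.bd (Suc i) v a + mvec (r' (Suc i)) (\<phi> (Suc i)) w a) =
      mvec (r' i) (\<phi> i) (G.bd i w)"
    by (simp add: mvec_add F.bd_bd \<phi>_bd)
  then show ?thesis
    by (cases i)
      (simp_all add: x cone_bd_Suc cone_bd_0[simplified] mvec_uminus G.bd_bd)
qed

text \<open>A diagram chase with \<open>x = (v, w)\<close>. The part \<open>w\<close> is a cycle of
  the source, or for \<open>i = 0\<close> lies in the colon ideal of \<open>J\<close> by
  \<open>u\<close> and hence in \<open>J'\<close>; so it is the boundary of some \<open>g\<close>.
  Then \<open>v + \<phi> g\<close> is a cycle of the target, hence the boundary of some
  \<open>f\<close>, and \<open>(f, - g)\<close> maps to \<open>x\<close>.\<close>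

lemma cone_exact:
  assumes J': "\<And>f. f \<in> poly_ring n \<Longrightarrow> u * f \<in> J \<Longrightarrow> f \<in> J'"
    and x: "x \<in> Vec n (cone_rank (Suc i))" and x0: "cone_bd i x = (\<lambda>_. 0)"
  shows "\<exists>y\<in>Vec n (cone_rank (Suc (Suc i))). x = cone_bd (Suc i) y"
proof -
  obtain v w where v: "v \<in> Vec n (r (Suc i))" and w: "w \<in> Vec n (r' i)"
    and x_eq: "x = vec_append (r (Suc i)) v w"
    using x unfolding cone_rank_Suc by (rule Vec_append_cases)
  have "(\<exists>g\<in>Vec n (r' (Suc i)). w = G.bd i g) \<and>
      (\<lambda>a. F.bd i v a + mvec (r' i) (\<phi> i) w a) = (\<lambda>_. 0)"
  proof (cases i)
    case 0
    have zero: "(\<lambda>a. F.bd i v a + mvec (r' i) (\<phi> i) w a) = (\<lambda>_. 0)"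
      using x0 by (simp add: x_eq 0 cone_bd_0[simplified])
    have "F.bd 0 v 0 + u * w 0 = 0"
      using fun_cong[OF zero, of 0] by (simp add: 0 \<phi>_0 G.rank_0 mvec_corner[simplified])
    then have "u * w 0 = F.bd 0 (\<lambda>a. - v a) 0"
      by (simp add: mvec_uminus eq_neg_iff_add_eq_0 add.commute)
    also have "\<dots> \<in> J" using v 0 by (intro F.bd_0_mem) auto
    finally have "w 0 \<in> J'" using w by (intro J') (auto simp: Vec_def)
    then obtain g where g: "g \<in> Vec n (r' 1)" "G.bd 0 g = (\<lambda>a. if a = 0 then w 0 else 0)"
      using G.mem_bd_0 by blast
    moreover have "w = (\<lambda>a. if a = 0 then w 0 else 0)"
      using w by (auto simp: 0 Vec_def G.rank_0)
    ultimately show ?thesis using zero 0 by (metis One_nat_def)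
  next
    case (Suc k)
    have Vec: "(\<lambda>a. F.bd i v a + mvec (r' i) (\<phi> i) w a) \<in> Vec n (r i)"
      using v w F.M_Mats \<phi>_Mats by blast
    note zero = vec_append_eq_zero[OF Vec x0[unfolded x_eq Suc cone_bd_Suc, folded Suc]]
    have "G.bd k w = (\<lambda>_. 0)" using zero(2) by (simp add: fun_eq_iff Suc)
    then show ?thesis using G.exact[of w k] w zero(1) by (simp add: Suc)
  qed
  then obtain g where g: "g \<in> Vec n (r' (Suc i))" "w = G.bd i g"
    and zero: "(\<lambda>a. F.bd i v a + mvec (r' i) (\<phi> i) w a) = (\<lambda>_. 0)" by blast
  have "\<exists>f\<in>Vec n (r (Suc (Suc i))). (\<lambda>a. v a + mvec (r' (Suc i)) (\<phi> (Suc i)) g a) = F.bd (Suc i) f"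
  proof (rule F.exact)
    show "(\<lambda>a. v a + mvec (r' (Suc i)) (\<phi> (Suc i)) g a) \<in> Vec n (r (Suc i))"
      using v g \<phi>_Mats by blast
    show "F.bd i (\<lambda>a. v a + mvec (r' (Suc i)) (\<phi> (Suc i)) g a) = (\<lambda>_. 0)"
      using zero by (simp add: mvec_add g(2) \<phi>_bd)
  qed
  then obtain f where f: "f \<in> Vec n (r (Suc (Suc i)))"
    "(\<lambda>a. v a + mvec (r' (Suc i)) (\<phi> (Suc i)) g a) = F.bd (Suc i) f" by blast
  have "vec_append (r (Suc (Suc i))) f (\<lambda>a. - g a) \<in> Vec n (cone_rank (Suc (Suc i)))"
    unfolding cone_rank_Suc using f(1) g(1) by (intro vec_append_Vec) auto
  moreover have "cone_bd (Suc i) (vec_append (r (Suc (Suc i))) f (\<lambda>a. - g a)) = x"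
    by (simp add: cone_bd_Suc f(2)[symmetric] mvec_uminus x_eq g(2))
  ultimately show ?thesis by metis
qed

lemma cone_image_0:
  "{cone_bd 0 v 0 | v. v \<in> Vec n (cone_rank 1)} = {f + u * g | f g. f \<in> J \<and> g \<in> poly_ring n}"
proof (intro equalityI subsetI)
  fix h assume "h \<in> {cone_bd 0 v 0 | v. v \<in> Vec n (cone_rank 1)}"
  then obtain x where x: "x \<in> Vec n (cone_rank (Suc 0))" "h = cone_bd 0 x 0" by auto
  obtain v w where v: "v \<in> Vec n (r (Suc 0))" and w: "w \<in> Vec n (r' 0)"
    and x_eq: "x = vec_append (r (Suc 0)) v w"
    using x(1) unfolding cone_rank_Suc by (rule Vec_append_cases)
  have "h = F.bd 0 v 0 + u * w 0"
    by (simp add: x x_eq cone_bd_0[simplified] \<phi>_0 G.rank_0 mvec_corner[simplified])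
  moreover have "F.bd 0 v 0 \<in> J" "w 0 \<in> poly_ring n"
    using v w F.bd_0_mem by (auto simp: Vec_def)
  ultimately show "h \<in> {f + u * g | f g. f \<in> J \<and> g \<in> poly_ring n}" by blast
next
  fix h assume "h \<in> {f + u * g | f g. f \<in> J \<and> g \<in> poly_ring n}"
  then obtain f g where h: "h = f + u * g" "f \<in> J" "g \<in> poly_ring n" by blast
  obtain v where v: "v \<in> Vec n (r 1)" "F.bd 0 v = (\<lambda>a. if a = 0 then f else 0)"
    using F.mem_bd_0[OF h(2)] by blast
  define w where "w = (\<lambda>a::nat. if a = 0 then g else 0)"
  have "w \<in> Vec n (r' 0)" using h(3) by (auto simp: w_def Vec_def G.rank_0)
  then have "vec_append (r 1) v w \<in> Vec n (cone_rank 1)"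
    using vec_append_Vec[OF v(1)] by (simp add: cone_rank_Suc)
  moreover have "h = cone_bd 0 (vec_append (r 1) v w) 0"
    unfolding cone_bd_0 v(2) by (simp add: h(1) \<phi>_0 G.rank_0 mvec_corner[simplified] w_def)
  ultimately show "h \<in> {cone_bd 0 v 0 | v. v \<in> Vec n (cone_rank 1)}" by blast
qed

text \<open>The cone realizes the exact sequence
  \<open>0 -> R/(J : u) -> R/J -> R/(J + (u)) -> 0\<close>. The existence of \<phi> implies that
  \<open>J'\<close> is contained in \<open>J : u\<close>, and the assumption gives the other
  inclusion.\<close>

lemma graded_res_cone:
  assumes J': "\<And>f. f \<in> poly_ring n \<Longrightarrow> u * f \<in> J \<Longrightarrow> f \<in> J'"
  shows "graded_res n {f + u * g | f g. f \<in> J \<and> g \<in> poly_ring n} cone_rank cone_dg cone_M"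
proof
  show "cone_rank 0 = 1" "cone_dg 0 0 = 0" by (simp_all add: cone_rank_def cone_dg_def F.dg_0)
  show "cone_M i \<in> Mats n (cone_rank i) (cone_rank (Suc i))" for i by (rule cone_Mats)
  show "homogeneous (cone_dg (Suc i) b - cone_dg i a) (cone_M i a b)" for i a b
    by (rule cone_homogeneous)
  show "{mvec (cone_rank 1) (cone_M 0) v 0 |v. v \<in> Vec n (cone_rank 1)} =
      {f + u * g | f g. f \<in> J \<and> g \<in> poly_ring n}"
    using cone_image_0 by simp
  show "mmult (cone_rank (Suc i)) (cone_M i) (cone_M (Suc i)) = (\<lambda>_ _. 0)" for i
  proof (rule Mats_eq_zeroI)
    show "mmult (cone_rank (Suc i)) (cone_M i) (cone_M (Suc i)) \<in> Mats n (cone_rank i) (cone_rank (Suc (Suc i)))"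
      using cone_Mats by blast
    show "mvec (cone_rank (Suc (Suc i))) (mmult (cone_rank (Suc i)) (cone_M i) (cone_M (Suc i))) v = (\<lambda>_. 0)"
      if "v \<in> Vec n (cone_rank (Suc (Suc i)))" for v
      using cone_bd_bd[OF that] by (simp add: mvec_mmult)
  qed
  show "\<exists>w\<in>Vec n (cone_rank (Suc (Suc i))). v = cone_bd (Suc i) w"
    if "v \<in> Vec n (cone_rank (Suc i))" "cone_bd i v = (\<lambda>_. 0)" for i v
    using cone_exact[OF J' that] by simp
qed

end

text \<open>As the ranks are nonzero exactly up to \<open>N\<close>, this number is the projective
  dimension of \<open>R/J\<close>. Minimality includes \<open>M 0\<close>, because the first
  differential of one resolution becomes a block of the second differential of a cone.\<close>

definition has_min_res :: "nat \<Rightarrow> 'a::field mvpoly set \<Rightarrow> nat \<Rightarrow> bool" where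
  "has_min_res n J N \<longleftrightarrow> (\<exists>r dg M. graded_res n J r dg M \<and>
     (\<forall>i a b. Poly_Mapping.lookup (M i a b) 0 = 0) \<and> (\<forall>i. r i \<noteq> 0 \<longleftrightarrow> i \<le> N))"

lemma has_min_res_zero: "has_min_res n {0} 0"
  unfolding has_min_res_def
proof (intro exI conjI)
  show "graded_res n {0} (\<lambda>i. if i = 0 then 1 else 0) (\<lambda>_ _. 0) (\<lambda>_ _ _. 0)"
    by unfold_locales (auto simp: Vec_def mvec_def)
qed auto

text \<open>The mapping cone is minimal because the comparison map can be chosen as a multiple of \<open>x\<close>.\<close>

lemma has_min_res_cone:
  assumes "has_min_res n J N" "has_min_res n {f \<in> poly_ring n. g * f \<in> J} N'"
    and x: "x \<in> poly_ring n" "homogeneous dx x" "Poly_Mapping.lookup x 0 = 0"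
    and g: "g \<in> poly_ring n" "homogeneous d g"
    and regular: "\<And>f. f \<in> poly_ring n \<Longrightarrow> x * f \<in> J \<Longrightarrow> f \<in> J"
  shows "has_min_res n {h + x * g * f | h f. h \<in> J \<and> f \<in> poly_ring n} (max N (Suc N'))"
proof -
  let ?J' = "{f \<in> poly_ring n. g * f \<in> J}"
  obtain r dg M where F: "graded_res n J r dg M" "\<forall>i a b. Poly_Mapping.lookup (M i a b) 0 = 0"
    "\<forall>i. r i \<noteq> 0 \<longleftrightarrow> i \<le> N" using assms(1) by (auto simp: has_min_res_def)
  obtain r' dg' M' where G: "graded_res n ?J' r' dg' M'" "\<forall>i a b. Poly_Mapping.lookup (M' i a b) 0 = 0"
    "\<forall>i. r' i \<noteq> 0 \<longleftrightarrow> i \<le> N'" using assms(2) by (auto simp: has_min_res_def)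
  \<comment> \<open>Only multiplication by \<open>g\<close> is lifted here; the factor
    \<open>x\<close> is put in front of the lift afterwards.\<close>
  obtain \<psi> where \<psi>: "\<And>i. \<psi> i \<in> Mats n (r i) (r' i)" "\<psi> 0 = corner g"
    "\<And>i a b. homogeneous (dg' i b + d - dg i a) (\<psi> i a b)"
    "\<And>i. mmult (r' i) (\<psi> i) (M' i) = mmult (r (Suc i)) (M i) (\<psi> (Suc i))"
    by (rule chain_lift[OF F(1) G(1) g]) auto
  define \<phi> where "\<phi> = (\<lambda>i a b. x * \<psi> i a b)"
  interpret chain_map n J r dg M ?J' r' dg' M' "d + dx" "x * g" \<phi>
  proof (rule chain_map.intro[OF F(1) G(1)], unfold_locales)
    show "\<phi> i \<in> Mats n (r i) (r' i)" for i
      using \<psi>(1)[of i] x(1) by (auto simp: \<phi>_def Mats_def)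
    show "\<phi> 0 = corner (x * g)" by (simp add: \<phi>_def \<psi>(2) corner_def fun_eq_iff)
    show "homogeneous (dg' i b + (d + dx) - dg i a) (\<phi> i a b)" for i a b
      using homogeneous_mult[OF x(2) \<psi>(3)[of i b a]] by (simp add: \<phi>_def algebra_simps)
    show "mmult (r' i) (\<phi> i) (M' i) = mmult (r (Suc i)) (M i) (\<phi> (Suc i))" for i
    proof (intro ext)
      fix a c
      have "mmult (r' i) (\<phi> i) (M' i) a c = x * mmult (r' i) (\<psi> i) (M' i) a c"
        by (simp add: \<phi>_def mmult_def sum_distrib_left mult.assoc)
      also have "\<dots> = mmult (r (Suc i)) (M i) (\<phi> (Suc i)) a c"
        by (simp add: \<psi>(4)) (simp add: \<phi>_def mmult_def sum_distrib_left mult.left_commute)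
      finally show "mmult (r' i) (\<phi> i) (M' i) a c = mmult (r (Suc i)) (M i) (\<phi> (Suc i)) a c" .
    qed
  qed
  have res: "graded_res n {h + x * g * f | h f. h \<in> J \<and> f \<in> poly_ring n} cone_rank cone_dg cone_M"
  proof (rule graded_res_cone)
    fix f assume "f \<in> poly_ring n" "x * g * f \<in> J"
    \<comment> \<open>Since \<open>x\<close> is regular modulo \<open>J\<close>, the colon ideals of
      \<open>J\<close> by \<open>x * g\<close> and by \<open>g\<close> agree.\<close>
    then show "f \<in> ?J'" using regular[of "g * f"] g(1) by (auto simp: mult.assoc)
  qed
  have "Poly_Mapping.lookup (\<phi> i a b) 0 = 0" for i a b
    by (simp add: \<phi>_def lookup_0_mult x(3))
  then have "Poly_Mapping.lookup (cone_M i a b) 0 = 0" for i a b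
    using F(2) G(2) by (auto simp: cone_M_def split: nat.split)
  moreover have "cone_rank i \<noteq> 0 \<longleftrightarrow> i \<le> max N (Suc N')" for i
  proof (cases i)
    case (Suc k)
    have "cone_rank i \<noteq> 0 \<longleftrightarrow> r (Suc k) \<noteq> 0 \<or> r' k \<noteq> 0"
      unfolding Suc cone_rank_Suc by (simp only: add_is_0 de_Morgan_conj)
    then show ?thesis
      unfolding F(3)[rule_format] G(3)[rule_format] by (simp add: Suc le_max_iff_disj)
  qed (simp add: cone_rank_def)
  ultimately show ?thesis using res unfolding has_min_res_def by blast
qed

subsection \<open>Squarefree monomial ideals\<close>

text \<open>A squarefree monomial is represented by the set of its variables.\<close>

definition sqf_exp :: "nat set \<Rightarrow> nat \<Rightarrow>\<^sub>0 nat" where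
  "sqf_exp S = (\<Sum>i\<in>S. Poly_Mapping.single i 1)"

definition sqf_mon :: "nat set \<Rightarrow> 'a::field mvpoly" where
  "sqf_mon S = (\<Prod>i\<in>S. pvar i)"

text \<open>Membership is tested monomial by monomial: the squarefree monomial of \<open>S\<close>
  divides the one with exponent \<open>t\<close> if and only if
  \<open>S \<subseteq> Poly_Mapping.keys t\<close>. Sums and colons become operations on sets of
  variables; \<open>ideal_gen_sqf_mon\<close> links this to generated ideals.\<close>

definition sqf_ideal :: "nat \<Rightarrow> nat set set \<Rightarrow> 'a::field mvpoly set" where
  "sqf_ideal n \<S> = {f \<in> poly_ring n. \<forall>t\<in>Poly_Mapping.keys f. \<exists>S\<in>\<S>. S \<subseteq> Poly_Mapping.keys t}"

lemma lookup_sqf_exp: "finite S \<Longrightarrow> Poly_Mapping.lookup (sqf_exp S) i = (if i \<in> S then 1 else 0)"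
  by (simp add: sqf_exp_def lookup_sum lookup_single when_def)

lemma keys_sqf_exp: "finite S \<Longrightarrow> Poly_Mapping.keys (sqf_exp S) = S"
  by (auto simp: in_keys_iff lookup_sqf_exp split: if_splits)

lemma sqf_mon_eq_single: "sqf_mon S = Poly_Mapping.single (sqf_exp S) 1"
  by (induction S rule: infinite_finite_induct) (auto simp: sqf_mon_def sqf_exp_def pvar_def mult_single)

lemma sqf_mon_in_poly_ring: "S \<subseteq> {1..n} \<Longrightarrow> sqf_mon S \<in> poly_ring n"
  unfolding sqf_mon_eq_single by (rule poly_ring_single) (auto simp: keys_sqf_exp finite_subset)

lemma homogeneous_sqf_mon: "homogeneous (int (mono_deg (sqf_exp S))) (sqf_mon S)"
  by (simp add: homogeneous_def sqf_mon_eq_single)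

lemma lookup_single_mult_shift:
  fixes a t :: "nat \<Rightarrow>\<^sub>0 nat" and f :: "'a::field mvpoly"
  shows "Poly_Mapping.lookup (Poly_Mapping.single a 1 * f) (a + t) = Poly_Mapping.lookup f t"
  by (simp add: lookup_mult lookup_single when_mult)

text \<open>Shifting exponents is injective, so no terms cancel.\<close>

lemma keys_sqf_mon_mult:
  "Poly_Mapping.keys (sqf_mon S * f) = (\<lambda>t. sqf_exp S + t) ` Poly_Mapping.keys f"
proof
  show "Poly_Mapping.keys (sqf_mon S * f) \<subseteq> (\<lambda>t. sqf_exp S + t) ` Poly_Mapping.keys f"
    using Poly_Mapping.keys_mult[of "sqf_mon S" f] by (auto simp: sqf_mon_eq_single)
  show "(\<lambda>t. sqf_exp S + t) ` Poly_Mapping.keys f \<subseteq> Poly_Mapping.keys (sqf_mon S * f)"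
    by (auto simp: sqf_mon_eq_single in_keys_iff lookup_single_mult_shift)
qed

lemma poly_mapping_eq_sum_single:
  "f = (\<Sum>t\<in>Poly_Mapping.keys f. Poly_Mapping.single t (Poly_Mapping.lookup f t))"
proof (rule poly_mapping_eqI)
  fix t
  have "Poly_Mapping.lookup (\<Sum>t\<in>Poly_Mapping.keys f. Poly_Mapping.single t (Poly_Mapping.lookup f t)) t
      = (\<Sum>t'\<in>Poly_Mapping.keys f. if t' = t then Poly_Mapping.lookup f t else 0)"
    unfolding lookup_sum by (rule sum.cong) (auto simp: lookup_single when_def)
  then show "Poly_Mapping.lookup f t =
      Poly_Mapping.lookup (\<Sum>t\<in>Poly_Mapping.keys f. Poly_Mapping.single t (Poly_Mapping.lookup f t)) t"
    by (simp add: in_keys_iff)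
qed

lemma single_eq_sqf_mon_mult:
  assumes "S \<subseteq> Poly_Mapping.keys t"
  shows "Poly_Mapping.single t c = sqf_mon S * Poly_Mapping.single (t - sqf_exp S) c"
proof -
  have "finite S" using assms finite_keys finite_subset by blast
  then have "t = sqf_exp S + (t - sqf_exp S)"
    using assms by (intro poly_mapping_eqI) (auto simp: lookup_add lookup_minus lookup_sqf_exp in_keys_iff)
  then show ?thesis by (simp add: sqf_mon_eq_single mult_single)
qed

lemma keys_minus_exp: "Poly_Mapping.keys (t - e) \<subseteq> Poly_Mapping.keys t"
  for t e :: "nat \<Rightarrow>\<^sub>0 nat"
  by (auto simp: in_keys_iff lookup_minus)

lemma sqf_ideal_in_poly_ring: "f \<in> sqf_ideal n \<S> \<Longrightarrow> f \<in> poly_ring n"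
  by (simp add: sqf_ideal_def)

lemma sqf_ideal_empty: "sqf_ideal n {} = {0}"
  by (auto simp: sqf_ideal_def)

lemma sqf_ideal_mono:
  assumes "\<And>S. S \<in> \<S> \<Longrightarrow> \<exists>T\<in>\<T>. T \<subseteq> S"
  shows "sqf_ideal n \<S> \<subseteq> sqf_ideal n \<T>"
proof
  fix f assume f: "f \<in> sqf_ideal n \<S>"
  have "\<exists>T\<in>\<T>. T \<subseteq> Poly_Mapping.keys t" if "t \<in> Poly_Mapping.keys f" for t
  proof -
    obtain S where S: "S \<in> \<S>" "S \<subseteq> Poly_Mapping.keys t" using f \<open>t \<in> _\<close> by (auto simp: sqf_ideal_def)
    obtain T where "T \<in> \<T>" "T \<subseteq> S" using assms[OF S(1)] by blast
    with S(2) show ?thesis by blast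
  qed
  with f show "f \<in> sqf_ideal n \<T>" by (simp add: sqf_ideal_def)
qed

lemma sqf_ideal_cong:
  assumes "\<And>S. S \<in> \<S> \<Longrightarrow> \<exists>T\<in>\<T>. T \<subseteq> S" "\<And>T. T \<in> \<T> \<Longrightarrow> \<exists>S\<in>\<S>. S \<subseteq> T"
  shows "sqf_ideal n \<S> = sqf_ideal n \<T>"
  using sqf_ideal_mono[of \<S> \<T> n] sqf_ideal_mono[of \<T> \<S> n] assms by (intro equalityI) blast+

lemma sqf_ideal_add:
  assumes "f \<in> sqf_ideal n \<S>" "g \<in> sqf_ideal n \<S>"
  shows "f + g \<in> sqf_ideal n \<S>"
  using assms Poly_Mapping.keys_add[of f g] by (auto simp: sqf_ideal_def)

lemma sqf_ideal_zero [simp]: "0 \<in> sqf_ideal n \<S>"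
  by (simp add: sqf_ideal_def)

lemma sqf_ideal_sum: "(\<And>i. i \<in> A \<Longrightarrow> f i \<in> sqf_ideal n \<S>) \<Longrightarrow> sum f A \<in> sqf_ideal n \<S>"
  by (induction A rule: infinite_finite_induct) (auto intro: sqf_ideal_add)

text \<open>Divisibility of a term of the product reads
  \<open>S \<subseteq> T \<union> Poly_Mapping.keys t\<close>; moving \<open>T\<close> to the other
  side gives the generators of the colon ideal.\<close>

lemma sqf_mon_mult_mem_iff:
  assumes "T \<subseteq> {1..n}" "f \<in> poly_ring n"
  shows "sqf_mon T * f \<in> sqf_ideal n \<S> \<longleftrightarrow> f \<in> sqf_ideal n ((\<lambda>S. S - T) ` \<S>)"
proof -
  have "finite T" using assms(1) finite_subset by blast
  moreover have "sqf_mon T * f \<in> poly_ring n"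
    using assms sqf_mon_in_poly_ring by blast
  ultimately show ?thesis
    using assms(2)
    by (simp add: sqf_ideal_def keys_sqf_mon_mult keys_plus_nat keys_sqf_exp Diff_subset_conv)
qed

lemma sqf_ideal_insert:
  assumes T: "T \<subseteq> {1..n}"
  shows "{h + sqf_mon T * f | h f. h \<in> sqf_ideal n \<S> \<and> f \<in> poly_ring n} = sqf_ideal n (insert T \<S>)"
proof (intro equalityI subsetI)
  have fin: "finite T" using T finite_subset by blast
  fix g :: "'a mvpoly" assume "g \<in> {h + sqf_mon T * f | h f. h \<in> sqf_ideal n \<S> \<and> f \<in> poly_ring n}"
  then obtain h f where g: "g = h + sqf_mon T * f" "h \<in> sqf_ideal n \<S>" "f \<in> poly_ring n" by blast
  have "h \<in> sqf_ideal n (insert T \<S>)" using g(2) by (auto simp: sqf_ideal_def)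
  moreover have "sqf_mon T * f \<in> sqf_ideal n (insert T \<S>)"
    using g(3) sqf_mon_in_poly_ring[OF T] fin
    by (auto simp: sqf_ideal_def keys_sqf_mon_mult keys_plus_nat keys_sqf_exp)
  ultimately show "g \<in> sqf_ideal n (insert T \<S>)" unfolding g(1) by (rule sqf_ideal_add)
next
  fix g :: "'a mvpoly" assume g: "g \<in> sqf_ideal n (insert T \<S>)"
  \<comment> \<open>The terms of \<open>g\<close> in \<open>K\<close> belong to the old ideal; all
    others are divisible by the monomial of \<open>T\<close>.\<close>
  define K where "K = {t \<in> Poly_Mapping.keys g. \<exists>S\<in>\<S>. S \<subseteq> Poly_Mapping.keys t}"
  define h where "h = (\<Sum>t\<in>K. Poly_Mapping.single t (Poly_Mapping.lookup g t))"
  define f where "f = (\<Sum>t\<in>Poly_Mapping.keys g - K. Poly_Mapping.single (t - sqf_exp T) (Poly_Mapping.lookup g t))"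
  have keys: "Poly_Mapping.keys t \<subseteq> {1..n}" if "t \<in> Poly_Mapping.keys g" for t
    using g that by (auto simp: sqf_ideal_def poly_ring_def)
  have "h \<in> sqf_ideal n \<S>"
    unfolding h_def
  proof (rule sqf_ideal_sum)
    fix t assume t: "t \<in> K"
    then have "Poly_Mapping.single t (Poly_Mapping.lookup g t) \<in> poly_ring n"
      by (intro poly_ring_single keys) (simp add: K_def)
    with t show "Poly_Mapping.single t (Poly_Mapping.lookup g t) \<in> sqf_ideal n \<S>"
      by (auto simp: K_def sqf_ideal_def)
  qed
  moreover have "f \<in> poly_ring n"
    unfolding f_def using keys keys_minus_exp by (intro poly_ring_sum poly_ring_single) blast
  moreover have "g = h + sqf_mon T * f"
  proof -
    have "sqf_mon T * f = (\<Sum>t\<in>Poly_Mapping.keys g - K. Poly_Mapping.single t (Poly_Mapping.lookup g t))"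
      unfolding f_def sum_distrib_left
    proof (rule sum.cong)
      fix t assume "t \<in> Poly_Mapping.keys g - K"
      then have "T \<subseteq> Poly_Mapping.keys t" using g by (auto simp: K_def sqf_ideal_def)
      then show "sqf_mon T * Poly_Mapping.single (t - sqf_exp T) (Poly_Mapping.lookup g t) =
          Poly_Mapping.single t (Poly_Mapping.lookup g t)"
        by (simp add: single_eq_sqf_mon_mult)
    qed simp
    moreover have "K \<subseteq> Poly_Mapping.keys g" by (auto simp: K_def)
    then have "(\<Sum>t\<in>Poly_Mapping.keys g. Poly_Mapping.single t (Poly_Mapping.lookup g t)) =
        (\<Sum>t\<in>Poly_Mapping.keys g - K. Poly_Mapping.single t (Poly_Mapping.lookup g t)) + h"
      unfolding h_def by (rule sum.subset_diff) simp
    ultimately show ?thesis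
      using poly_mapping_eq_sum_single[of g] by (metis add.commute)
  qed
  ultimately show "g \<in> {h + sqf_mon T * f | h f. h \<in> sqf_ideal n \<S> \<and> f \<in> poly_ring n}" by blast
qed

lemma ideal_gen_sqf_mon:
  assumes \<S>: "\<And>S. S \<in> \<S> \<Longrightarrow> S \<subseteq> {1..n}"
  shows "ideal_gen n (sqf_mon ` \<S>) = sqf_ideal n \<S>"
proof (intro equalityI subsetI)
  fix f :: "'a mvpoly" assume "f \<in> ideal_gen n (sqf_mon ` \<S>)"
  then obtain U c where U: "U \<subseteq> sqf_mon ` \<S>" "f = (\<Sum>u\<in>U. c u * u)" "\<And>u. u \<in> U \<Longrightarrow> c u \<in> poly_ring n"
    by (auto simp: ideal_gen_def)
  show "f \<in> sqf_ideal n \<S>"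
    unfolding U(2)
  proof (rule sqf_ideal_sum)
    fix u assume u: "u \<in> U"
    then obtain S where S: "S \<in> \<S>" "u = sqf_mon S" using U(1) by blast
    then have fin: "finite S" using \<S> finite_subset by blast
    have "sqf_mon S * c u \<in> poly_ring n"
      using U(3)[OF u] sqf_mon_in_poly_ring[OF \<S>[OF S(1)]] by blast
    then have "sqf_mon S * c u \<in> sqf_ideal n \<S>"
      using S(1) fin by (auto simp: sqf_ideal_def keys_sqf_mon_mult keys_plus_nat keys_sqf_exp)
    then show "c u * u \<in> sqf_ideal n \<S>" by (simp add: S(2) mult.commute)
  qed
next
  fix f :: "'a mvpoly" assume f: "f \<in> sqf_ideal n \<S>"
  then obtain \<sigma> where \<sigma>: "\<And>t. t \<in> Poly_Mapping.keys f \<Longrightarrow> \<sigma> t \<in> \<S>"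
    "\<And>t. t \<in> Poly_Mapping.keys f \<Longrightarrow> \<sigma> t \<subseteq> Poly_Mapping.keys t"
    unfolding sqf_ideal_def by (auto; metis)
  define u where "u = (\<lambda>t. sqf_mon (\<sigma> t) :: 'a mvpoly)"
  define g where "g = (\<lambda>t. Poly_Mapping.single (t - sqf_exp (\<sigma> t)) (Poly_Mapping.lookup f t))"
  \<comment> \<open>Several monomials may have been assigned the same generator, while
    \<open>ideal_gen\<close> allows one coefficient per element, so their cofactors are added
    up.\<close>
  define c where "c = (\<lambda>v. \<Sum>t | t \<in> Poly_Mapping.keys f \<and> u t = v. g t)"
  have g: "g t \<in> poly_ring n" if "t \<in> Poly_Mapping.keys f" for t
    unfolding g_def using f that keys_minus_exp[of t]
    by (intro poly_ring_single) (fastforce simp: sqf_ideal_def poly_ring_def)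
  have "f = (\<Sum>t\<in>Poly_Mapping.keys f. g t * u t)"
    by (subst poly_mapping_eq_sum_single[of f], rule sum.cong)
      (auto simp: g_def u_def single_eq_sqf_mon_mult[OF \<sigma>(2)] mult.commute)
  also have "\<dots> = (\<Sum>v\<in>u ` Poly_Mapping.keys f. \<Sum>t | t \<in> Poly_Mapping.keys f \<and> u t = v. g t * u t)"
    by (rule sum.image_gen) simp
  also have "\<dots> = (\<Sum>v\<in>u ` Poly_Mapping.keys f. c v * v)"
    by (auto simp: c_def sum_distrib_right intro!: sum.cong)
  finally have "f = (\<Sum>v\<in>u ` Poly_Mapping.keys f. c v * v)" .
  moreover have "u ` Poly_Mapping.keys f \<subseteq> sqf_mon ` \<S>" using \<sigma>(1) by (auto simp: u_def)
  moreover have "\<forall>v\<in>u ` Poly_Mapping.keys f. c v \<in> poly_ring n"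
    using g by (auto simp: c_def)
  ultimately show "f \<in> ideal_gen n (sqf_mon ` \<S>)"
    unfolding ideal_gen_def using finite_keys by blast
qed

text \<open>This turns minimality into the vanishing of constant terms: a monomial is nonconstant
  exactly if some variable divides it.\<close>

lemma maximal_ideal_eq: "ideal_gen n (pvar ` {1..n}) = {f \<in> poly_ring n. Poly_Mapping.lookup f 0 = 0}"
proof -
  have "ideal_gen n (pvar ` {1..n}) = ideal_gen n (sqf_mon ` (\<lambda>i. {i}) ` {1..n} :: 'a mvpoly set)"
    by (simp add: image_image sqf_mon_def)
  also have "\<dots> = sqf_ideal n ((\<lambda>i. {i}) ` {1..n})" by (rule ideal_gen_sqf_mon) auto
  also have "\<dots> = {f \<in> poly_ring n. Poly_Mapping.lookup f 0 = 0}"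
  proof -
    have *: "(\<exists>S\<in>(\<lambda>i. {i}) ` {1..n}. S \<subseteq> Poly_Mapping.keys t) \<longleftrightarrow> t \<noteq> 0"
      if "Poly_Mapping.keys t \<subseteq> {1..n}" for t :: "nat \<Rightarrow>\<^sub>0 nat"
    proof -
      have "(\<exists>S\<in>(\<lambda>i. {i}) ` {1..n}. S \<subseteq> Poly_Mapping.keys t) \<longleftrightarrow> Poly_Mapping.keys t \<inter> {1..n} \<noteq> {}"
        by blast
      also have "\<dots> \<longleftrightarrow> t \<noteq> 0" using that by (simp add: Int_absorb2)
      finally show ?thesis .
    qed
    have "f \<in> sqf_ideal n ((\<lambda>i. {i}) ` {1..n}) \<longleftrightarrow> f \<in> poly_ring n \<and> (\<forall>t\<in>Poly_Mapping.keys f. t \<noteq> 0)"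
      for f :: "'a mvpoly"
      unfolding sqf_ideal_def poly_ring_def using * by blast
    moreover have "(\<forall>t\<in>Poly_Mapping.keys f. t \<noteq> 0) \<longleftrightarrow> Poly_Mapping.lookup f 0 = 0" for f :: "'a mvpoly"
      by (metis in_keys_iff)
    ultimately show ?thesis by blast
  qed
  finally show ?thesis .
qed

text \<open>The cone construction for the monomial of \<open>T\<close>, written as \<open>x\<close>
  times the monomial of \<open>T - {x}\<close>. The variable \<open>x\<close> is regular modulo the
  old ideal because no generator involves it.\<close>

lemma has_min_res_insert:
  assumes res: "has_min_res n (sqf_ideal n \<S> :: 'a::field mvpoly set) N"
    "has_min_res n (sqf_ideal n ((\<lambda>S. S - T) ` \<S>) :: 'a mvpoly set) N'"
    and T: "T \<subseteq> {1..n}" and x: "x \<in> T" "\<And>S. S \<in> \<S> \<Longrightarrow> x \<notin> S"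
  shows "has_min_res n (sqf_ideal n (insert T \<S>) :: 'a mvpoly set) (max N (Suc N'))"
proof -
  let ?x = "sqf_mon {x} :: 'a mvpoly" and ?g = "sqf_mon (T - {x}) :: 'a mvpoly"
  have fin: "finite T" using T finite_subset by blast
  have Tx: "{x} \<subseteq> {1..n}" "T - {x} \<subseteq> {1..n}" using T x by auto
  have xg: "?x * ?g = sqf_mon T"
    using prod.remove[OF fin x(1), of "pvar :: nat \<Rightarrow> 'a mvpoly"] by (simp add: sqf_mon_def)
  \<comment> \<open>As no \<open>S\<close> contains \<open>x\<close>, the colon ideals by the
    monomials of \<open>T - {x}\<close> and of \<open>T\<close> have the same generators.\<close>
  have eq: "(\<lambda>S. S - (T - {x})) ` \<S> = (\<lambda>S. S - T) ` \<S>"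
    using x(2) by (intro image_cong) auto
  have "f \<in> poly_ring n \<and> ?g * f \<in> sqf_ideal n \<S> \<longleftrightarrow> f \<in> sqf_ideal n ((\<lambda>S. S - T) ` \<S>)" for f
    using sqf_mon_mult_mem_iff[OF Tx(2), of f \<S>] sqf_ideal_in_poly_ring[of f] unfolding eq by blast
  then have colon: "{f \<in> poly_ring n. ?g * f \<in> sqf_ideal n \<S>} = sqf_ideal n ((\<lambda>S. S - T) ` \<S>)"
    by blast
  have "has_min_res n {h + ?x * ?g * f | h f. h \<in> sqf_ideal n \<S> \<and> f \<in> poly_ring n} (max N (Suc N'))"
  proof (rule has_min_res_cone[OF res(1)])
    show "has_min_res n {f \<in> poly_ring n. ?g * f \<in> sqf_ideal n \<S>} N'"
      using res(2) by (simp only: colon)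
    show "?x \<in> poly_ring n" "?g \<in> poly_ring n" by (rule sqf_mon_in_poly_ring[OF Tx(1)] sqf_mon_in_poly_ring[OF Tx(2)])+
    show "Poly_Mapping.lookup ?x 0 = 0"
      using keys_sqf_exp[of "{x}"] by (auto simp: sqf_mon_eq_single lookup_single when_def)
    show "f \<in> sqf_ideal n \<S>" if f: "f \<in> poly_ring n" "?x * f \<in> sqf_ideal n \<S>" for f
    proof -
      have "(\<lambda>S. S - {x}) ` \<S> = \<S>" using x(2) by (auto intro!: image_eqI)
      then show ?thesis using f sqf_mon_mult_mem_iff[OF Tx(1) f(1), of \<S>] by simp
    qed
  qed (rule homogeneous_sqf_mon)+
  then show ?thesis by (simp only: xg sqf_ideal_insert[OF T])
qed

subsection \<open>Windows\<close>

text \<open>With \<open>m = q * t + s\<close> these are the variables of the generator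
  \<open>u (Suc i)\<close>: windows are numbered from \<open>0\<close>, variables from
  \<open>1\<close>.\<close>

definition window :: "nat \<Rightarrow> nat \<Rightarrow> nat \<Rightarrow> nat \<Rightarrow> nat set" where
  "window t q s i = {i * t + 1..i * t + q * t + s}"

text \<open>This is the projective dimension of \<open>R/I\<close>, one more than that of \<open>I\<close>, for the ideal \<open>I\<close>
  generated by \<open>k\<close> windows.\<close>

definition window_pd :: "nat \<Rightarrow> nat \<Rightarrow> nat" where
  "window_pd q k = 2 * ((k + q - 1) div (q + 1)) + (if (k + q - 1) mod (q + 1) = q then 1 else 0)"

lemma window_pd_0: "0 < q \<Longrightarrow> window_pd q 0 = 0"
  by (simp add: window_pd_def)

lemma window_pd_1: "window_pd q (Suc 0) = Suc 0"
  by (simp add: window_pd_def)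

text \<open>Adding \<open>q + 1\<close> to the dividend adds \<open>2\<close> to the value, so the
  second entry of the maximum is the value itself, and monotonicity bounds the first. For
  \<open>k < q\<close> the truncated difference \<open>k - q\<close> is \<open>0\<close>, and the
  value at \<open>Suc k\<close> is \<open>2\<close>.\<close>

lemma window_pd_Suc:
  assumes "0 < q" "0 < k"
  shows "window_pd q (Suc k) = max (window_pd q k) (Suc (Suc (window_pd q (k - q))))"
proof -
  have mono: "window_pd q k \<le> window_pd q (Suc k)"
  proof -
    define N where "N = k + q - 1"
    have N: "k + q - 1 = N" "Suc k + q - 1 = Suc N" using assms by (auto simp: N_def)
    have "N mod (q + 1) < q + 1" by simp
    then show ?thesis
      unfolding window_pd_def N by (auto simp: mod_Suc div_Suc)
  qed
  have "window_pd q (Suc k) = Suc (Suc (window_pd q (k - q)))"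
  proof (cases "q \<le> k")
    case True
    then have N: "Suc k + q - 1 = (k - q + q - 1) + (q + 1)" using assms by simp
    have "(N + (q + 1)) div (q + 1) = N div (q + 1) + 1" "(N + (q + 1)) mod (q + 1) = N mod (q + 1)" for N
      by (rule div_add_self2, simp, rule mod_add_self2)
    then show ?thesis unfolding window_pd_def N by simp
  next
    case False
    then have N: "Suc k + q - 1 = (k - 1) + (q + 1)" and "k - 1 < q" using assms by auto
    have "(Suc k + q - 1) div (q + 1) = (k - 1) div (q + 1) + 1"
      "(Suc k + q - 1) mod (q + 1) = (k - 1) mod (q + 1)"
      unfolding N by (rule div_add_self2, simp, rule mod_add_self2)
    then have "window_pd q (Suc k) = 2"
      unfolding window_pd_def using \<open>k - 1 < q\<close> by simp
    then show ?thesis using False window_pd_0[OF assms(1)] by simp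
  qed
  then show ?thesis using mono by simp
qed

text \<open>The last window may be truncated because the induction meets the colon of a window by the
  next full block of \<open>t\<close> variables, which deletes the last \<open>s\<close> variables of the window.\<close>

lemma has_min_res_windows:
  assumes t: "0 < s" "s < t" and q: "0 < q"
  shows "{k * t + 1..k * t + q * t} \<subseteq> Z \<Longrightarrow> Z \<subseteq> window t q s k \<Longrightarrow> Z \<subseteq> {1..n} \<Longrightarrow>
    has_min_res n (sqf_ideal n (insert Z (window t q s ` {..<k})) :: 'a::field mvpoly set) (window_pd q (Suc k))"
proof (induction k arbitrary: Z rule: less_induct)
  case (less k)
  let ?W = "window t q s"
  have step: "i * t + t \<le> j * t" if "i < j" for i j
    using mult_le_mono1[of "Suc i" j t] that by simp
  have qt: "0 < q * t" using t q by simp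
  \<comment> \<open>This variable ends the last full block of the window, so every admissible
    truncation keeps it, and the earlier windows stop before it since \<open>s < t\<close>. It
    serves as the \<open>x\<close> of \<open>has_min_res_insert\<close>.\<close>
  have x: "k * t + q * t \<in> Z"
    using less.prems(1) qt by auto
  then have kn: "k * t + q * t \<le> n"
    using less.prems(3) by auto
  \<comment> \<open>The untruncated case of the induction hypothesis, with the zero ideal for
    \<open>j = 0\<close>.\<close>
  have all: "has_min_res n (sqf_ideal n (?W ` {..<j}) :: 'a mvpoly set) (window_pd q j)"
    if "j \<le> k" for j
  proof (cases j)
    case 0
    then show ?thesis by (simp add: sqf_ideal_empty has_min_res_zero window_pd_0[OF q])
  next
    case (Suc i)
    have "?W i \<subseteq> {1..n}" using step[of i k] Suc that t kn by (auto simp: window_def)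
    moreover have "{i * t + 1..i * t + q * t} \<subseteq> ?W i" by (auto simp: window_def)
    ultimately show ?thesis
      using less.IH[of i "?W i"] Suc that by (simp add: lessThan_Suc)
  qed
  have x_notin: "k * t + q * t \<notin> ?W i" if "i < k" for i
    using step[OF that] t by (auto simp: window_def)
  show ?case
  proof (cases "k = 0")
    case True
    have "has_min_res n (sqf_ideal n (insert Z {}) :: 'a mvpoly set) (max 0 (Suc 0))"
      by (rule has_min_res_insert[OF _ _ less.prems(3) x])
        (auto simp: sqf_ideal_empty has_min_res_zero)
    then show ?thesis by (simp add: True window_pd_1)
  next
    case False
    define j where "j = k - 1"
    have k: "k = Suc j" using False by (simp add: j_def)
    define K where "K = k - q"
    \<comment> \<open>The block just before window \<open>k\<close>: it is what remains of window
      \<open>j\<close> after removing \<open>Z\<close>.\<close>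
    define V where "V = {j * t + 1..k * t}"
    have V: "has_min_res n (sqf_ideal n (insert V (?W ` {..<K})) :: 'a mvpoly set) (Suc (window_pd q K))"
    proof -
      have far: "i * t + q * t \<le> j * t" if "i < K" for i
        using mult_le_mono1[of "i + q" j t] that by (simp add: K_def k add_mult_distrib)
      have "has_min_res n (sqf_ideal n ((\<lambda>S. S - V) ` ?W ` {..<K}) :: 'a mvpoly set) (window_pd q K)"
      proof (cases K)
        case 0
        then show ?thesis by (simp add: sqf_ideal_empty has_min_res_zero window_pd_0[OF q])
      next
        case (Suc K')
        have j: "j = K' + q" using Suc by (simp add: K_def k)
        let ?Z = "{K' * t + 1..K' * t + q * t}"
        \<comment> \<open>Window \<open>K'\<close> reaches exactly \<open>s\<close> variables into
          \<open>V\<close>, so removing \<open>V\<close> leaves its \<open>q\<close> full blocks.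
          This is where truncated windows arise.\<close>
        have "?W K' - V = ?Z"
          using t by (auto simp: window_def V_def j k add_mult_distrib)
        moreover have "?W i - V = ?W i" if "i < K'" for i
          using step[OF that] t by (auto simp: window_def V_def j add_mult_distrib)
        ultimately have "(\<lambda>S. S - V) ` ?W ` {..<K} = insert ?Z (?W ` {..<K'})"
          by (auto simp: Suc lessThan_Suc image_image)
        moreover have "has_min_res n (sqf_ideal n (insert ?Z (?W ` {..<K'})) :: 'a mvpoly set) (window_pd q (Suc K'))"
        proof (rule less.IH)
          show "K' < k" by (simp add: k j)
          show "?Z \<subseteq> ?W K'" by (auto simp: window_def)
          show "?Z \<subseteq> {1..n}" using far[of K'] kn Suc k by auto
        qed simp
        ultimately show ?thesis by (simp add: Suc)
      qed
      moreover have "K \<le> k" by (simp add: K_def)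
      ultimately have "has_min_res n (sqf_ideal n (insert V (?W ` {..<K})) :: 'a mvpoly set)
          (max (window_pd q K) (Suc (window_pd q K)))"
      proof (intro has_min_res_insert[OF all])
        show "V \<subseteq> {1..n}" using kn by (auto simp: V_def)
        \<comment> \<open>The last variable of \<open>V\<close> avoids all windows below
          \<open>K\<close>, which end at \<open>j * t + s\<close> at the latest.\<close>
        show "k * t \<in> V" using t by (simp add: V_def k)
        show "k * t \<notin> S" if "S \<in> ?W ` {..<K}" for S
          using that far t by (force simp: window_def k)
      qed
      then show ?thesis by simp
    qed
    \<comment> \<open>The colon ideal by the monomial of \<open>Z\<close>: windows below
      \<open>K\<close> are disjoint from \<open>Z\<close> and remain, while windows \<open>K\<close>
      to \<open>j\<close> still contain \<open>V\<close> after losing \<open>Z\<close>, and window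
      \<open>j\<close> leaves exactly \<open>V\<close>.\<close>
    have "sqf_ideal n ((\<lambda>S. S - Z) ` ?W ` {..<k}) = (sqf_ideal n (insert V (?W ` {..<K})) :: 'a mvpoly set)"
    proof (rule sqf_ideal_cong)
      fix S assume "S \<in> (\<lambda>S. S - Z) ` ?W ` {..<k}"
      then obtain i where i: "i < k" "S = ?W i - Z" by auto
      show "\<exists>T\<in>insert V (?W ` {..<K}). T \<subseteq> S"
      proof (cases "i < K")
        case True
        then have "i * t + q * t \<le> j * t"
          using mult_le_mono1[of "i + q" j t] by (simp add: K_def k add_mult_distrib)
        then have "?W i \<inter> Z = {}" using less.prems(2) t by (force simp: window_def k)
        then have "?W i \<subseteq> S" by (auto simp: i)
        with True show ?thesis by blast
      next
        case False
        then have "k * t \<le> i * t + q * t"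
          using mult_le_mono1[of k "i + q" t] by (simp add: K_def add_mult_distrib)
        moreover have "i * t \<le> j * t" using i(1) by (simp add: k)
        moreover have "V \<inter> Z = {}" using less.prems(2) by (fastforce simp: V_def window_def)
        moreover have "y \<in> ?W i" if "y \<in> V" for y
          using that calculation(1,2) unfolding V_def window_def atLeastAtMost_iff by linarith
        ultimately have "V \<subseteq> S" by (auto simp: i)
        then show ?thesis by blast
      qed
    next
      fix T assume "T \<in> insert V (?W ` {..<K})"
      then consider "T = V" | i where "i < K" "T = ?W i" by auto
      then show "\<exists>S\<in>(\<lambda>S. S - Z) ` ?W ` {..<k}. S \<subseteq> T"
      proof cases
        case 1
        have "y \<in> V" if y: "y \<in> ?W j - Z" for y
        proof (rule ccontr)
          assume "y \<notin> V"
          then have "y \<in> {k * t + 1..k * t + q * t}" using y t by (auto simp: window_def V_def k)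
          then show False using y less.prems(1) by blast
        qed
        then show ?thesis using 1 by (auto simp: k)
      next
        case 2
        then show ?thesis by (auto simp: K_def intro!: bexI[of _ i])
      qed
    qed
    with V have "has_min_res n (sqf_ideal n ((\<lambda>S. S - Z) ` ?W ` {..<k}) :: 'a mvpoly set) (Suc (window_pd q K))"
      by simp
    then have "has_min_res n (sqf_ideal n (insert Z (?W ` {..<k})) :: 'a mvpoly set)
        (max (window_pd q k) (Suc (Suc (window_pd q K))))"
      by (rule has_min_res_insert[OF all[OF order_refl] _ less.prems(3) x]) (use x_notin in auto)
    then show ?thesis using window_pd_Suc[OF q, of k] False by (simp add: K_def)
  qed
qed

subsection \<open>Betti numbers\<close>

text \<open>The dictionary between resolutions of \<open>I\<close> by lists and matrices and
  resolutions of \<open>R/I\<close> by functions, with homological degrees shifted by one. It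
  assumes neither exactness nor minimality, so that it serves for both directions of the
  translation.\<close>

locale resolution_matrices =
  fixes n :: nat and r :: "nat \<Rightarrow> nat" and dg :: "nat \<Rightarrow> nat \<Rightarrow> int"
    and M :: "nat \<Rightarrow> nat \<Rightarrow> nat \<Rightarrow> 'a::field mvpoly"
    and tw :: "nat \<Rightarrow> int list" and aug :: "'a mvpoly vec" and D :: "nat \<Rightarrow> 'a mvpoly mat"
  assumes rank_0: "r 0 = 1" and dg_0: "dg 0 0 = 0"
    and length_tw: "\<And>i. length (tw i) = r (Suc i)"
    and nth_tw: "\<And>i a. a < r (Suc i) \<Longrightarrow> tw i ! a = dg (Suc i) a"
    and aug_dim: "aug \<in> carrier_vec (r 1)"
    and aug_nth: "\<And>b. b < r 1 \<Longrightarrow> aug $ b = M 0 0 b"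
    and D_dim: "\<And>i. D i \<in> carrier_mat (r (Suc i)) (r (Suc (Suc i)))"
    and D_nth: "\<And>i a b. a < r (Suc i) \<Longrightarrow> b < r (Suc (Suc i)) \<Longrightarrow> D i $$ (a, b) = M (Suc i) a b"
    and M_Mats: "\<And>i. M i \<in> Mats n (r i) (r (Suc i))"
begin

lemma aug_vec: "aug \<bullet> vec (r 1) v = mvec (r 1) (M 0) v 0"
  by (simp add: scalar_prod_def mvec_def aug_nth atLeast0LessThan)

lemma D_vec: "D i *\<^sub>v vec (r (Suc (Suc i))) v = vec (r (Suc i)) (mvec (r (Suc (Suc i))) (M (Suc i)) v)"
proof (rule eq_vecI)
  fix a assume "a < dim_vec (vec (r (Suc i)) (mvec (r (Suc (Suc i))) (M (Suc i)) v))"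
  then have a: "a < r (Suc i)" by simp
  have "dim_row (D i) = r (Suc i)" "dim_col (D i) = r (Suc (Suc i))" using D_dim[of i] by auto
  with a show "(D i *\<^sub>v vec (r (Suc (Suc i))) v) $ a = vec (r (Suc i)) (mvec (r (Suc (Suc i))) (M (Suc i)) v) $ a"
    by (simp add: scalar_prod_def mvec_def D_nth atLeast0LessThan)
qed (use D_dim[of i] in auto)

lemma free_mod_eq: "free_mod n q = vec q ` (Vec n q :: (nat \<Rightarrow> 'a mvpoly) set)"
proof (intro equalityI subsetI)
  fix x :: "'a mvpoly vec" assume x: "x \<in> free_mod n q"
  then have "(\<lambda>a. if a < q then x $ a else 0) \<in> Vec n q" by (auto simp: free_mod_def Vec_def)
  moreover have "x = vec q (\<lambda>a. if a < q then x $ a else 0)"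
    using x by (intro eq_vecI) (auto simp: free_mod_def)
  ultimately show "x \<in> vec q ` Vec n q" by blast
qed (auto simp: free_mod_def Vec_def)

lemma vec_eq_iff: "v \<in> Vec n q \<Longrightarrow> w \<in> Vec n q \<Longrightarrow> vec q v = vec q w \<longleftrightarrow> v = w"
proof
  assume vw: "v \<in> Vec n q" "w \<in> Vec n q" "vec q v = vec q w"
  show "v = w"
  proof
    fix a show "v a = w a"
      using vw(1,2) arg_cong[OF vw(3), of "\<lambda>x. x $ a"] by (cases "a < q") (auto simp: Vec_def)
  qed
qed simp

lemma mvec_M_Vec: "v \<in> Vec n (r (Suc i)) \<Longrightarrow> mvec (r (Suc i)) (M i) v \<in> Vec n (r i)"
  using M_Mats by blast

lemma mvec_M_0_outside: "0 < a \<Longrightarrow> mvec (r 1) (M 0) v a = 0"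
  using M_Mats[of 0] by (auto simp: mvec_def Mats_def rank_0)

lemma mvec_M_0_eq_0_iff: "mvec (r 1) (M 0) v = (\<lambda>_. 0) \<longleftrightarrow> mvec (r 1) (M 0) v 0 = 0"
  using mvec_M_0_outside[of _ v] by (metis neq0_conv)

lemma zero_vec_iff: "v \<in> Vec n q \<Longrightarrow> vec q v = 0\<^sub>v q \<longleftrightarrow> v = (\<lambda>_. 0)"
  using vec_eq_iff[of v q "\<lambda>_. 0"] by (simp add: zero_vec_def)

abbreviation ker where "ker i \<equiv> {v \<in> Vec n (r (Suc i)). mvec (r (Suc i)) (M i) v = (\<lambda>_. 0)}"
abbreviation img where "img i \<equiv> mvec (r (Suc i)) (M i) ` Vec n (r (Suc i))"

lemma inj_on_vec: "inj_on (vec q) (Vec n q)"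
  by (auto simp: inj_on_def vec_eq_iff)

lemma aug_image: "{aug \<bullet> v | v. v \<in> free_mod n (length (tw 0))} = {mvec (r 1) (M 0) v 0 | v. v \<in> Vec n (r 1)}"
  by (auto simp: length_tw free_mod_eq aug_vec[simplified]) (metis aug_vec One_nat_def image_eqI)+

text \<open>The map \<open>vec\<close> is injective on \<open>Vec\<close>, so kernel and image may
  be compared before it is applied.\<close>

lemma exact_0_iff:
  "{v \<in> free_mod n (length (tw 0)). aug \<bullet> v = 0} = {D 0 *\<^sub>v w | w. w \<in> free_mod n (length (tw 1))} \<longleftrightarrow>
    ker 0 = img 1"
proof -
  have "{v \<in> free_mod n (length (tw 0)). aug \<bullet> v = 0} = vec (r (Suc 0)) ` ker 0"
    using mvec_M_0_eq_0_iff by (auto simp: length_tw free_mod_eq aug_vec[simplified])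
  moreover have "{D 0 *\<^sub>v w | w. w \<in> free_mod n (length (tw 1))} = vec (r (Suc 0)) ` img 1"
    by (simp add: length_tw free_mod_eq D_vec Setcompr_eq_image image_image)
  moreover have "ker 0 \<subseteq> Vec n (r (Suc 0))" "img 1 \<subseteq> Vec n (r (Suc 0))"
    using mvec_M_Vec by auto
  ultimately show ?thesis
    by (simp only: inj_on_image_eq_iff[OF inj_on_vec])
qed

lemma exact_Suc_iff:
  "{v \<in> free_mod n (length (tw (Suc i))). D i *\<^sub>v v = 0\<^sub>v (length (tw i))} =
     {D (Suc i) *\<^sub>v w | w. w \<in> free_mod n (length (tw (Suc (Suc i))))} \<longleftrightarrow> ker (Suc i) = img (Suc (Suc i))"
proof -
  have "{v \<in> free_mod n (length (tw (Suc i))). D i *\<^sub>v v = 0\<^sub>v (length (tw i))} =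
      vec (r (Suc (Suc i))) ` ker (Suc i)"
    using zero_vec_iff[OF mvec_M_Vec] by (auto simp: length_tw free_mod_eq D_vec)
  moreover have "{D (Suc i) *\<^sub>v w | w. w \<in> free_mod n (length (tw (Suc (Suc i))))} =
      vec (r (Suc (Suc i))) ` img (Suc (Suc i))"
    by (simp add: length_tw free_mod_eq D_vec Setcompr_eq_image image_image)
  moreover have "ker (Suc i) \<subseteq> Vec n (r (Suc (Suc i)))" "img (Suc (Suc i)) \<subseteq> Vec n (r (Suc (Suc i)))"
    using mvec_M_Vec by auto
  ultimately show ?thesis
    by (simp only: inj_on_image_eq_iff[OF inj_on_vec])
qed

lemma graded_res_of_minimal:
  assumes "minimal_graded_free_resolution n I tw aug D"
    and hom: "\<And>i a b. homogeneous (dg (Suc i) b - dg i a) (M i a b)"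
  shows "graded_res n I r dg M"
proof -
  interpret minimal_graded_free_resolution n I tw aug D by fact
  have ker: "ker i = img (Suc i)" for i
  proof (cases i)
    case 0
    then show ?thesis using exact_0 exact_0_iff by simp
  next
    case (Suc j)
    then show ?thesis using exact_Suc[of j] exact_Suc_iff[of j] by simp
  qed
  show ?thesis
  proof
    show "{mvec (r 1) (M 0) v 0 |v. v \<in> Vec n (r 1)} = I"
      using aug_surj aug_image by simp
    show "mmult (r (Suc i)) (M i) (M (Suc i)) = (\<lambda>_ _. 0)" for i
    proof (rule Mats_eq_zeroI)
      show "mmult (r (Suc i)) (M i) (M (Suc i)) \<in> Mats n (r i) (r (Suc (Suc i)))"
        using M_Mats by blast
      show "mvec (r (Suc (Suc i))) (mmult (r (Suc i)) (M i) (M (Suc i))) v = (\<lambda>_. 0)"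
        if "v \<in> Vec n (r (Suc (Suc i)))" for v
        using ker[of i] that unfolding mvec_mmult by blast
    qed
    show "\<exists>w\<in>Vec n (r (Suc (Suc i))). v = mvec (r (Suc (Suc i))) (M (Suc i)) w"
      if "v \<in> Vec n (r (Suc i))" "mvec (r (Suc i)) (M i) v = (\<lambda>_. 0)" for i v
      using ker[of i] that by blast
  qed (fact rank_0 dg_0 M_Mats hom)+
qed

lemma minimal_of_graded_res:
  assumes "graded_res n I r dg M" and min: "\<And>i a b. Poly_Mapping.lookup (M i a b) 0 = 0"
  shows "minimal_graded_free_resolution n I tw aug D"
proof -
  interpret graded_res n I r dg M by fact
  have ker: "ker i = img (Suc i)" for i
  proof (intro equalityI subsetI)
    fix v assume "v \<in> img (Suc i)"
    then show "v \<in> ker i" using mvec_M_Vec bd_bd by blast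
  qed (use exact in blast)
  have M_P: "M i a b \<in> poly_ring n" for i a b
    using M_Mats[of i] by (simp add: Mats_def)
  have D_el: "\<exists>a b. x = M (Suc i) a b" if "x \<in> elements_mat (D i)" for i x
  proof -
    have "dim_row (D i) = r (Suc i)" "dim_col (D i) = r (Suc (Suc i))" using D_dim[of i] by auto
    with elements_matD[OF that] D_nth show ?thesis by metis
  qed
  show ?thesis
  proof
    show "aug \<in> free_mod n (length (tw 0))"
      using aug_dim M_P by (auto simp: free_mod_def length_tw aug_nth)
    show "homogeneous (tw 0 ! a) (aug $ a)" if "a < length (tw 0)" for a
      using that M_homogeneous[of 0 a 0] by (simp add: length_tw aug_nth nth_tw dg_0)
    show "D i \<in> carrier_mat (length (tw i)) (length (tw (Suc i)))" for i
      using D_dim by (simp add: length_tw)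
    show "elements_mat (D i) \<subseteq> poly_ring n" for i
      using D_el M_P by blast
    show "homogeneous (tw (Suc i) ! b - tw i ! a) (D i $$ (a, b))"
      if "a < length (tw i)" "b < length (tw (Suc i))" for i a b
      using that M_homogeneous[of "Suc i" b a] by (simp add: length_tw D_nth nth_tw)
    show "{aug \<bullet> v | v. v \<in> free_mod n (length (tw 0))} = I"
      unfolding aug_image using image_0 by simp
    show "{v \<in> free_mod n (length (tw 0)). aug \<bullet> v = 0} = {D 0 *\<^sub>v w | w. w \<in> free_mod n (length (tw 1))}"
      unfolding exact_0_iff using ker[of 0] by simp
    show "{v \<in> free_mod n (length (tw (Suc i))). D i *\<^sub>v v = 0\<^sub>v (length (tw i))} =
        {D (Suc i) *\<^sub>v w | w. w \<in> free_mod n (length (tw (Suc (Suc i))))}" for i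
      unfolding exact_Suc_iff using ker[of "Suc i"] by simp
    show "elements_mat (D i) \<subseteq> ideal_gen n (pvar ` {1..n})" for i
    proof
      fix x assume "x \<in> elements_mat (D i)"
      from D_el[OF this] show "x \<in> ideal_gen n (pvar ` {1..n})"
        unfolding maximal_ideal_eq using M_P min by blast
    qed
  qed
qed

end

text \<open>The map \<open>aug\<close> becomes the first differential, into a copy of
  \<open>R\<close> placed in front. Minimality is obtained only for the later differentials, as
  constant terms of \<open>aug\<close> are not restricted.\<close>

lemma graded_res_of_minimal_resolution:
  fixes I :: "'a::field mvpoly set"
  assumes "minimal_graded_free_resolution n I tw aug D"
  obtains r dg M where "graded_res n I r dg M" "\<And>i a b. Poly_Mapping.lookup (M (Suc i) a b) 0 = 0"
    "\<And>i. r (Suc i) = length (tw i)" "\<And>i a. a < length (tw i) \<Longrightarrow> dg (Suc i) a = tw i ! a"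
proof -
  interpret R: minimal_graded_free_resolution n I tw aug D by fact
  define r where "r = (\<lambda>i. case i of 0 \<Rightarrow> 1 | Suc k \<Rightarrow> length (tw k))"
  define dg where "dg = (\<lambda>i a. case i of 0 \<Rightarrow> 0 | Suc k \<Rightarrow> tw k ! a)"
  define M where "M = (\<lambda>i a b. case i of
      0 \<Rightarrow> if a = 0 \<and> b < length (tw 0) then aug $ b else 0
    | Suc k \<Rightarrow> if a < length (tw k) \<and> b < length (tw (Suc k)) then D k $$ (a, b) else 0)"
  have el: "D k $$ (a, b) \<in> elements_mat (D k)" if "a < length (tw k)" "b < length (tw (Suc k))" for k a b
    using R.D_carrier that by (intro elements_matI) auto
  have M_Mats: "M i \<in> Mats n (r i) (r (Suc i))" for i
  proof (cases i)
    case 0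
    then show ?thesis using R.aug_carrier by (auto simp: Mats_def M_def r_def free_mod_def)
  next
    case (Suc k)
    then show ?thesis using R.D_entries[of k] el[of _ k] by (auto simp: Mats_def M_def r_def)
  qed
  have hom: "homogeneous (dg (Suc i) b - dg i a) (M i a b)" for i a b
    using R.aug_graded R.D_graded by (cases i) (auto simp: dg_def M_def)
  interpret resolution_matrices n r dg M tw aug D
    by unfold_locales
      (use R.aug_carrier R.D_carrier M_Mats in \<open>auto simp: r_def dg_def M_def free_mod_def\<close>)
  show ?thesis
  proof (rule that)
    show "graded_res n I r dg M" by (rule graded_res_of_minimal) (fact, rule hom)
    show "Poly_Mapping.lookup (M (Suc i) a b) 0 = 0" for i a b
      using R.minimal[of i, unfolded maximal_ideal_eq] el[of a i b] by (auto simp: M_def)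
  qed (simp_all add: r_def dg_def)
qed

section \<open>Uniqueness of the graded Betti numbers, and the projective dimension\<close>

lemma count_list_nth: "count_list xs x = card {a. a < length xs \<and> xs ! a = x}"
  by (simp add: count_list_eq_length_filter length_filter_conv_card eq_commute)

text \<open>Both resolutions are minimal, so \<open>betti_le\<close> applies in both directions.
  This justifies the definite description in \<open>graded_betti\<close>.\<close>

theorem count_twists_unique:
  fixes I :: "'a::field mvpoly set"
  assumes "minimal_graded_free_resolution n I tw aug D" "minimal_graded_free_resolution n I tw' aug' D'"
  shows "count_list (tw i) j = count_list (tw' i) j"
proof -
  have le: "count_list (tw i) j \<le> count_list (tw' i) j"
    if 1: "minimal_graded_free_resolution n I tw aug D" and 2: "minimal_graded_free_resolution n I tw' aug' D'"
    for tw tw' and aug aug' :: "'a mvpoly vec" and D D'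
  proof -
    obtain r dg M where F: "graded_res n I r dg M" "\<And>i a b. Poly_Mapping.lookup (M (Suc i) a b) 0 = 0"
      "\<And>i. r (Suc i) = length (tw i)" "\<And>i a. a < length (tw i) \<Longrightarrow> dg (Suc i) a = tw i ! a"
      using graded_res_of_minimal_resolution[OF 1] by metis
    obtain r' dg' M' where G: "graded_res n I r' dg' M'"
      "\<And>i. r' (Suc i) = length (tw' i)" "\<And>i a. a < length (tw' i) \<Longrightarrow> dg' (Suc i) a = tw' i ! a"
      using graded_res_of_minimal_resolution[OF 2] by metis
    have "card {a. a < r (Suc i) \<and> dg (Suc i) a = j} \<le> card {a. a < r' (Suc i) \<and> dg' (Suc i) a = j}"
      using F(1) G(1) F(2) by (rule betti_le)
    also have "{a. a < r (Suc i) \<and> dg (Suc i) a = j} = {a. a < length (tw i) \<and> tw i ! a = j}"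
      using F(3,4) by auto
    also have "{a. a < r' (Suc i) \<and> dg' (Suc i) a = j} = {a. a < length (tw' i) \<and> tw' i ! a = j}"
      using G(2,3) by auto
    finally show ?thesis by (simp only: count_list_nth)
  qed
  show ?thesis using le[OF assms] le[OF assms(2,1)] by simp
qed

lemma graded_betti_eq:
  assumes "minimal_graded_free_resolution n I tw aug D"
  shows "graded_betti n I i j = count_list (tw i) j"
  unfolding graded_betti_def
proof (rule the_equality)
  show "\<exists>tw' aug D. minimal_graded_free_resolution n I tw' aug D \<and> count_list (tw i) j = count_list (tw' i) j"
    using assms by blast
qed (use count_twists_unique[OF assms] in force)

text \<open>Removing \<open>F_0 = R\<close> turns a minimal resolution of \<open>R/I\<close> of
  length \<open>Suc N\<close> into one of \<open>I\<close> of length \<open>N\<close>, with nonzero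
  Betti numbers in exactly the degrees up to \<open>N\<close>.\<close>

lemma proj_dim_eq:
  fixes I :: "'a::field mvpoly set"
  assumes "has_min_res n I (Suc N)"
  shows "proj_dim n I = N"
proof -
  obtain r dg M where F: "graded_res n I r dg M" and min: "\<And>i a b. Poly_Mapping.lookup (M i a b) 0 = 0"
    and len: "\<And>i. r i \<noteq> 0 \<longleftrightarrow> i \<le> Suc N" using assms by (auto simp: has_min_res_def)
  interpret F: graded_res n I r dg M by (rule F)
  define tw where "tw = (\<lambda>i. map (dg (Suc i)) [0..<r (Suc i)])"
  define aug where "aug = vec (r 1) (M 0 0)"
  define D where "D = (\<lambda>i. mat (r (Suc i)) (r (Suc (Suc i))) (\<lambda>(a, b). M (Suc i) a b))"
  interpret resolution_matrices n r dg M tw aug D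
    by unfold_locales (simp_all add: tw_def aug_def D_def F.rank_0 F.dg_0 F.M_Mats)
  have res: "minimal_graded_free_resolution n I tw aug D"
    using F min by (rule minimal_of_graded_res)
  have "(\<exists>j. graded_betti n I i j \<noteq> 0) \<longleftrightarrow> i \<le> N" for i
  proof -
    have "(\<exists>j. graded_betti n I i j \<noteq> 0) \<longleftrightarrow> tw i \<noteq> []"
      unfolding graded_betti_eq[OF res] count_list_0_iff by (metis list.set_intros(1) neq_Nil_conv empty_iff list.set(1))
    also have "\<dots> \<longleftrightarrow> i \<le> N" using len[of "Suc i"] by (simp add: tw_def)
    finally show ?thesis .
  qed
  then have "{i. \<exists>j. graded_betti n I i j \<noteq> 0} = {..N}" by auto
  then show ?thesis by (simp add: proj_dim_def Max_eq_iff)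
qed

section \<open>Division of \<open>n\<close> by the period of the recursion\<close>

theorem theorem3p10:
  fixes k l m n :: nat and s p d :: int
    and u :: "nat \<Rightarrow> 'a::field mvpoly" and I :: "'a mvpoly set"
  assumes "n = k * (m - l) + l"
    and "k \<ge> 1" and "m \<ge> 2"
    and "\<lceil>real m / 2\<rceil> \<le> int l" and "l < m"
    and "\<And>i. 1 \<le> i \<Longrightarrow> i \<le> k \<Longrightarrow> u i = (\<Prod>j = 1..m. pvar ((i - 1) * (m - l) + j))"
    and "I = ideal_gen n (u ` {1..k})"
    and "[int m = s] (mod (int m - int l))" and "1 \<le> s" and "s < int m - int l"
    and "int n = p * (2 * int m - int l - s) + d"
    and "0 \<le> d" and "d < 2 * int m - int l - s"
  shows "(d \<noteq> int m \<longrightarrow> int (proj_dim n I) = 2 * p - 1) \<and>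
         (d = int m \<longrightarrow> int (proj_dim n I) = 2 * p)"
proof -
  define t where "t = m - l"
  define q where "q = m div t"
  define \<sigma> where "\<sigma> = m mod t"
  have t: "int t = int m - int l" "t > 0" using assms(5) by (simp_all add: t_def)
  \<comment> \<open>In the range from \<open>1\<close> to \<open>t - 1\<close> the congruence
    determines \<open>s\<close> as the remainder of \<open>m\<close>.\<close>
  have "s mod int t = s" using assms(9,10) t by simp
  then have s: "s = int \<sigma>"
    using assms(8) t(1) by (simp add: cong_def \<sigma>_def zmod_int)
  have \<sigma>: "0 < \<sigma>" "\<sigma> < t" using assms(9) s t(2) by (simp_all add: \<sigma>_def)
  have m: "m = q * t + \<sigma>" by (simp add: q_def \<sigma>_def)
  have "t \<le> m" using t(1) by linarith
  then have q: "0 < q" using t(2) by (simp add: q_def div_greater_zero_iff)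
  obtain k' where k: "k = Suc k'" using assms(2) by (cases k) auto
  have n: "n = k' * t + m" using assms(1,5) by (simp add: k t_def)
  have "u ` {1..k} = sqf_mon ` window t q \<sigma> ` {..<k}"
  proof -
    have "u (Suc i) = sqf_mon (window t q \<sigma> i)" if "i < k" for i
    proof -
      have "u (Suc i) = (\<Prod>j = 1..m. pvar (i * t + j))" using assms(6)[of "Suc i"] that by (simp add: t_def)
      also have "\<dots> = (\<Prod>j\<in>(\<lambda>j. i * t + j) ` {1..m}. pvar j)"
        by (subst prod.reindex) auto
      also have "(\<lambda>j. i * t + j) ` {1..m} = window t q \<sigma> i"
        unfolding window_def using m by (simp add: add.assoc)
      finally show ?thesis by (simp add: sqf_mon_def)
    qed
    moreover have "{1..k} = Suc ` {..<k}" by (auto simp: image_Suc_lessThan)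
    ultimately show ?thesis by (force simp: image_image)
  qed
  moreover have sub: "window t q \<sigma> i \<subseteq> {1..n}" if "i < k" for i
  proof -
    have "i * t \<le> k' * t" using that by (simp add: k)
    then show ?thesis using n m by (auto simp: window_def)
  qed
  ultimately have I: "I = sqf_ideal n (window t q \<sigma> ` {..<k})"
    unfolding assms(7) by (simp only:) (rule ideal_gen_sqf_mon, auto)
  have "has_min_res n (sqf_ideal n (insert (window t q \<sigma> k') (window t q \<sigma> ` {..<k'})) :: 'a mvpoly set)
      (window_pd q (Suc k'))"
    using \<sigma> q by (rule has_min_res_windows) (use sub[of k'] in \<open>auto simp: window_def k\<close>)
  then have res: "has_min_res n I (window_pd q k)"
    by (simp add: I k lessThan_Suc)
  \<comment> \<open>Quotient and remainder as in \<open>window_pd\<close>, because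
    \<open>k + q - 1 = k' + q\<close>.\<close>
  define a where "a = (k' + q) div (q + 1)"
  define b where "b = (k' + q) mod (q + 1)"
  have ab: "k' + q = a * (q + 1) + b"
    unfolding a_def b_def by (rule div_mult_mod_eq[symmetric])
  have b: "b \<le> q" using mod_less_divisor[of "q + 1" "k' + q"] by (simp add: b_def)
  define L where "L = (q + 1) * t"
  \<comment> \<open>The divisor is \<open>(m - s) + (m - l) = q * t + t\<close>.\<close>
  have period: "2 * int m - int l - s = int L"
    using t(1) s m by (simp add: L_def algebra_simps)
  \<comment> \<open>This rewrites \<open>n = (k' + q) * t + \<sigma>\<close>. As
    \<open>b * t + \<sigma>\<close> is below \<open>L\<close>, uniqueness of division identifies
    \<open>p\<close> with \<open>a\<close> and \<open>d\<close> with
    \<open>b * t + \<sigma>\<close>, which is \<open>m\<close> exactly if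
    \<open>b = q\<close>.\<close>
  have n': "n = a * L + (b * t + \<sigma>)"
    unfolding L_def mult.assoc[symmetric] add.assoc[symmetric] add_mult_distrib[symmetric]
      ab[symmetric] n m by (simp add: algebra_simps)
  have "b * t \<le> q * t" using b by simp
  then have "b * t + \<sigma> < L" using \<sigma>(2) unfolding L_def add_mult_distrib by linarith
  then have "n div L = a" "n mod L = b * t + \<sigma>" by (simp_all add: n')
  then have "int n div int L = int a" "int n mod int L = int (b * t + \<sigma>)"
    by (simp_all only: zdiv_int[symmetric] zmod_int[symmetric])
  moreover have "int n div int L = p" "int n mod int L = d"
    using assms(11-13) unfolding period by (simp_all add: div_pos_pos_trivial)
  ultimately have p: "p = int a" and d: "d = int (b * t + \<sigma>)" by auto
  have dm: "d = int m \<longleftrightarrow> b = q" using t(2) by (simp add: d m)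
  have pd: "window_pd q k = 2 * a + (if b = q then 1 else 0)"
    by (simp add: window_pd_def a_def b_def k)
  \<comment> \<open>For \<open>a = 0\<close> the remainder \<open>b\<close> is
    \<open>k' + q\<close>, hence at least \<open>q\<close>. So the value for \<open>R/I\<close> is
    positive, and the projective dimension of \<open>I\<close> is one less.\<close>
  have "b = q" if "a = 0" using ab b that by simp
  then have "window_pd q k > 0" by (auto simp: pd)
  then obtain N where N: "window_pd q k = Suc N" by (cases "window_pd q k") auto
  have "proj_dim n I = N" using res unfolding N by (rule proj_dim_eq)
  then show ?thesis using N pd by (auto simp: dm p split: if_splits)
qed

end
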